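(* Let $\mathbb{F}$ be a field, let $n\ge 1$, and let $R=\mathbb{F}[x_1,\ldots,x_n]$ with the standard grading. Suppose that $f_1,\ldots,f_n$ is a regular sequence in $R$, and let $I=\langle f_1,\ldots,f_n\rangle$. Suppose further that for each $1\le i\le n$ the polynomial $f_i$ splits into a product of linear factors, i.e. $f_i=\ell_{i,1}\cdots\ell_{i,N_i}$ for some linear forms $\ell_{i,j}\in R$ (homogeneous of degree $1$). Then the complete intersection $R/I$ embeds into some quadratic complete intersection: there exist an integer $m\ge 0$, a regular sequence $g_1,\ldots,g_m$ of quadratic forms in $S=\mathbb{F}[y_1,\ldots,y_m]$ (standard grading), and a graded $\mathbb{F}$-algebra homomorphism $R/I\to S/\langle g_1,\ldots,g_m\rangle$ which maps a socle generator of $R/I$ onto a socle generator of $S/\langle g_1,\ldots,g_m\rangle$.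
   Context: The standard grading means every variable has degree $1$. A regular sequence in a polynomial ring in $n$ variables over $\mathbb{F}$ is a sequence of exactly $n$ homogeneous polynomials $f_1,\ldots,f_n$ of positive degree such that $f_1\ne 0$ and, for each $2\le i\le n$, $f_i$ is not a zero divisor in $R/\langle f_1,\ldots,f_{i-1}\rangle$. The quotient $R/\langle f_1,\ldots,f_n\rangle$ by a regular sequence is called a complete intersection; it is called a quadratic complete intersection if all the $f_i$ are quadratic forms (homogeneous of degree $2$). A complete intersection is a graded Artinian Gorenstein algebra, so its socle (the annihilator of its ideal of positive-degree elements) is a one-dimensional graded subspace; a socle generator is a nonzero element of the socle. A graded $\mathbb{F}$-algebra homomorphism between two complete intersections is called an embedding if it maps a socle generator onto a socle generator. By convention, for $m=0$ the polynomial ring in $m$ variables is $\mathbb{F}$ with the empty regular sequence, and the quotient is $\mathbb{F}$ itself. *)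

theory Defs
  imports "HOL-Library.Poly_Mapping" "HOL-Algebra.QuotRing"
begin

text \<open>
  A monomial is a finitely supported exponent vector, a polynomial a finitely supported
  coefficient function on monomials. The number of variables is controlled by the carrier:
  \<open>mpoly_ring n\<close> is the polynomial ring in the variables with indices \<open>1, \<dots>, n\<close>, so that
  \<open>n\<close> can be quantified over and \<open>mpoly_ring 0\<close> consists of the constants.
\<close>

type_synonym 'a mpoly = "(nat \<Rightarrow>\<^sub>0 nat) \<Rightarrow>\<^sub>0 'a"

definition mpoly_ring :: "nat \<Rightarrow> 'a::field mpoly ring" where
  "mpoly_ring n =
     \<lparr>carrier = {p. \<forall>t \<in> Poly_Mapping.keys p. Poly_Mapping.keys t \<subseteq> {1..n}},
      mult = (*), one = 1, zero = 0, add = (+)\<rparr>"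

lemma cring_mpoly_ring: "cring (mpoly_ring n :: 'a::field mpoly ring)"
proof (rule cringI)
  show "abelian_group (mpoly_ring n :: 'a mpoly ring)"
  proof (rule abelian_groupI)
    fix p :: "'a mpoly"
    assume "p \<in> carrier (mpoly_ring n)"
    then have "- p \<in> carrier (mpoly_ring n)" "- p \<oplus>\<^bsub>mpoly_ring n\<^esub> p = \<zero>\<^bsub>mpoly_ring n\<^esub>"
      by (simp_all add: mpoly_ring_def)
    then show "\<exists>q\<in>carrier (mpoly_ring n). q \<oplus>\<^bsub>mpoly_ring n\<^esub> p = \<zero>\<^bsub>mpoly_ring n\<^esub>"
      by blast
  next
    fix p q :: "'a mpoly"
    assume "p \<in> carrier (mpoly_ring n)" "q \<in> carrier (mpoly_ring n)"
    then show "p \<oplus>\<^bsub>mpoly_ring n\<^esub> q \<in> carrier (mpoly_ring n)"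
      using Poly_Mapping.keys_add[of p q] by (fastforce simp: mpoly_ring_def)
  qed (auto simp: mpoly_ring_def algebra_simps)
  show "Group.comm_monoid (mpoly_ring n :: 'a mpoly ring)"
  proof (rule comm_monoidI)
    fix p q :: "'a mpoly"
    assume pq: "p \<in> carrier (mpoly_ring n)" "q \<in> carrier (mpoly_ring n)"
    have "Poly_Mapping.keys t \<subseteq> {1..n}" if t: "t \<in> Poly_Mapping.keys (p * q)" for t
    proof -
      obtain a b where ab: "t = a + b" "a \<in> Poly_Mapping.keys p" "b \<in> Poly_Mapping.keys q"
        using t Poly_Mapping.keys_mult[of p q] by blast
      then have "Poly_Mapping.keys a \<subseteq> {1..n}" "Poly_Mapping.keys b \<subseteq> {1..n}"
        using pq by (auto simp: mpoly_ring_def)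
      then show ?thesis
        using ab(1) Poly_Mapping.keys_add[of a b] by blast
    qed
    then show "p \<otimes>\<^bsub>mpoly_ring n\<^esub> q \<in> carrier (mpoly_ring n)"
      by (simp add: mpoly_ring_def)
  qed (auto simp: mpoly_ring_def algebra_simps)
qed (auto simp: mpoly_ring_def algebra_simps)

abbreviation const_poly :: "'a::field \<Rightarrow> 'a mpoly" where
  "const_poly c \<equiv> Poly_Mapping.single 0 c"

definition monom_degree :: "(nat \<Rightarrow>\<^sub>0 nat) \<Rightarrow> nat" where
  "monom_degree t = (\<Sum>i\<in>Poly_Mapping.keys t. Poly_Mapping.lookup t i)"

text \<open>The zero polynomial counts as homogeneous of every degree.\<close>

definition forms :: "nat \<Rightarrow> nat \<Rightarrow> 'a::field mpoly set" where
  "forms n d = {p \<in> carrier (mpoly_ring n). \<forall>t\<in>Poly_Mapping.keys p. monom_degree t = d}"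

definition zero_divisor :: "('a, 'b) ring_scheme \<Rightarrow> 'a \<Rightarrow> bool" where
  "zero_divisor Q a \<longleftrightarrow>
     a \<in> carrier Q \<and> (\<exists>b\<in>carrier Q. b \<noteq> \<zero>\<^bsub>Q\<^esub> \<and> a \<otimes>\<^bsub>Q\<^esub> b = \<zero>\<^bsub>Q\<^esub>)"

text \<open>
  Regular sequences have exactly as many members as there are variables. The guard \<open>1 \<le> n\<close>
  makes the empty sequence regular for \<open>n = 0\<close>.
\<close>

definition regular_sequence :: "nat \<Rightarrow> (nat \<Rightarrow> 'a::field mpoly) \<Rightarrow> bool" where
  "regular_sequence n f \<longleftrightarrow>
     (\<forall>i\<in>{1..n}. \<exists>d>0. f i \<in> forms n d) \<and>
     (1 \<le> n \<longrightarrow> f 1 \<noteq> 0) \<and>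
     (\<forall>i\<in>{2..n}. let J = Idl\<^bsub>mpoly_ring n\<^esub> (f ` {1..i - 1}) in
        \<not> zero_divisor (mpoly_ring n Quot J) (J +>\<^bsub>mpoly_ring n\<^esub> f i))"

definition quadratic_regular_sequence :: "nat \<Rightarrow> (nat \<Rightarrow> 'a::field mpoly) \<Rightarrow> bool" where
  "quadratic_regular_sequence n f \<longleftrightarrow>
     regular_sequence n f \<and> (\<forall>i\<in>{1..n}. f i \<in> forms n 2)"

definition seq_ideal :: "nat \<Rightarrow> (nat \<Rightarrow> 'a::field mpoly) \<Rightarrow> 'a mpoly set" where
  "seq_ideal n f = Idl\<^bsub>mpoly_ring n\<^esub> (f ` {1..n})"

definition graded_part :: "nat \<Rightarrow> 'a::field mpoly set \<Rightarrow> nat \<Rightarrow> 'a mpoly set set" where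
  "graded_part n I d = (\<lambda>p. I +>\<^bsub>mpoly_ring n\<^esub> p) ` forms n d"

definition positive_ideal :: "nat \<Rightarrow> 'a::field mpoly set \<Rightarrow> 'a mpoly set set" where
  "positive_ideal n I = Idl\<^bsub>mpoly_ring n Quot I\<^esub> (\<Union>d\<in>{1..}. graded_part n I d)"

definition socle :: "nat \<Rightarrow> 'a::field mpoly set \<Rightarrow> 'a mpoly set set" where
  "socle n I =
     {s \<in> carrier (mpoly_ring n Quot I). \<forall>a\<in>positive_ideal n I.
        s \<otimes>\<^bsub>mpoly_ring n Quot I\<^esub> a = \<zero>\<^bsub>mpoly_ring n Quot I\<^esub>}"

definition socle_generator :: "nat \<Rightarrow> 'a::field mpoly set \<Rightarrow> 'a mpoly set \<Rightarrow> bool" where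
  "socle_generator n I s \<longleftrightarrow> s \<in> socle n I \<and> s \<noteq> \<zero>\<^bsub>mpoly_ring n Quot I\<^esub>"

text \<open>
  Given that a map is a ring homomorphism, compatibility with the structure maps from the
  coefficient field makes it an algebra homomorphism.
\<close>

definition graded_alg_hom ::
    "nat \<Rightarrow> 'a::field mpoly set \<Rightarrow> nat \<Rightarrow> 'a mpoly set \<Rightarrow> ('a mpoly set \<Rightarrow> 'a mpoly set) \<Rightarrow> bool" where
  "graded_alg_hom n I m J \<phi> \<longleftrightarrow>
     \<phi> \<in> ring_hom (mpoly_ring n Quot I) (mpoly_ring m Quot J) \<and>
     (\<forall>c. \<phi> (I +>\<^bsub>mpoly_ring n\<^esub> const_poly c) = J +>\<^bsub>mpoly_ring m\<^esub> const_poly c) \<and>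
     (\<forall>d. \<phi> ` graded_part n I d \<subseteq> graded_part m J d)"

definition ci_embedding ::
    "nat \<Rightarrow> 'a::field mpoly set \<Rightarrow> nat \<Rightarrow> 'a mpoly set \<Rightarrow> ('a mpoly set \<Rightarrow> 'a mpoly set) \<Rightarrow> bool" where
  "ci_embedding n I m J \<phi> \<longleftrightarrow>
     graded_alg_hom n I m J \<phi> \<and> (\<exists>s. socle_generator n I s \<and> socle_generator m J (\<phi> s))"

end

theory Submission
  imports Defs "Jordan_Normal_Form.Determinant"
begin

text \<open>
  A sequence of \<open>n\<close> products of linear forms \<open>f i = p i 1 * \<dots> * p i (N i)\<close> in \<open>n\<close> variables is
  regular iff the origin is its only common zero with coordinates in the ground field
  (\<open>regular_sequence_prod_linear_iff\<close>). Regularity of a sequence is multiplicative in each entry, so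
  the sequence is regular iff every choice of one linear factor from each \<open>f i\<close> is regular, and \<open>n\<close>
  linear forms are regular iff they are linearly independent, which is a statement about common
  zeros. Points over the ground field suffice because everything splits into linear factors.

  This criterion reduces the theorem to writing down the right quadrics. By the criterion the last
  factors \<open>p i (N i)\<close> form a basis of the linear forms. Take a new polynomial ring with a variable
  \<open>z i j\<close> for \<open>1 \<le> i \<le> n\<close> and \<open>2 \<le> j \<le> N i\<close>, put \<open>z i 1 = 0\<close>, let \<open>subst \<theta>\<close> be the algebra homomorphism
  that sends \<open>p i (N i)\<close> to \<open>z i (N i)\<close>, and take the quadrics

    \<open>(subst \<theta> (p i j) - z i j) * (z i (j + 1) - z i j)\<close>  for \<open>1 \<le> j < N i\<close>.

  There are as many quadrics as variables. At a common zero, \<open>z i j\<close> stays \<open>0\<close> as \<open>j\<close> grows until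
  \<open>p i j = z i j\<close> for some \<open>j\<close>, which happens at \<open>j = N i\<close> at the latest; so some factor of every \<open>f i\<close>
  vanishes, hence so do all linear forms in the old variables, and then all \<open>z i j\<close>. Thus the
  quadrics form a regular sequence. Modulo the quadrics, induction on \<open>j\<close> gives
  \<open>p i 1 * \<dots> * p i (j - 1) * z i j = 0\<close>; for \<open>j = N i\<close> this says that \<open>f i\<close> is mapped to \<open>0\<close>.

  As for socles, \<open>s = \<Prod>i. p i 1 * \<dots> * p i (N i - 1)\<close> is annihilated by every \<open>p i (N i)\<close>, hence by all
  forms of positive degree. Its image is congruent to the product of the first factors of all
  quadrics. That product is annihilated by all the second factors, which generate the linear forms
  too, and it is nonzero because the quadrics form a regular sequence
  (\<open>mult_prod_in_adjoin_list_imp\<close>). In particular \<open>s\<close> itself is nonzero, so both are socle generators.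
\<close>

section \<open>Ideals and regular sequences in a subring\<close>

text \<open>
  The polynomial rings in \<open>n\<close> variables are subrings of one type, so ideals and zero divisors are
  taken relative to a subring. This keeps ring identities within reach of the simplifier.
\<close>

locale unital_subring =
  fixes C :: "'b::comm_ring_1 set"
  assumes zero_mem [simp, intro]: "0 \<in> C"
    and one_mem [simp, intro]: "1 \<in> C"
    and add_mem [intro]: "a \<in> C \<Longrightarrow> b \<in> C \<Longrightarrow> a + b \<in> C"
    and uminus_mem [intro]: "a \<in> C \<Longrightarrow> - a \<in> C"
    and mult_mem [intro]: "a \<in> C \<Longrightarrow> b \<in> C \<Longrightarrow> a * b \<in> C"
begin

lemma diff_mem [intro]: "a \<in> C \<Longrightarrow> b \<in> C \<Longrightarrow> a - b \<in> C"
  using add_mem[of a "- b"] by auto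

lemma sum_mem: "(\<And>x. x \<in> A \<Longrightarrow> h x \<in> C) \<Longrightarrow> sum h A \<in> C"
  by (induction A rule: infinite_finite_induct) auto

lemma prod_mem: "(\<And>x. x \<in> A \<Longrightarrow> h x \<in> C) \<Longrightarrow> prod h A \<in> C"
  by (induction A rule: infinite_finite_induct) auto

lemma power_mem: "a \<in> C \<Longrightarrow> a ^ k \<in> C"
  by (induction k) auto

lemma prod_list_mem: "set xs \<subseteq> C \<Longrightarrow> prod_list xs \<in> C"
  by (induction xs) auto

definition ideal_in :: "'b set \<Rightarrow> bool" where
  "ideal_in I \<longleftrightarrow> I \<subseteq> C \<and> 0 \<in> I \<and> (\<forall>a\<in>I. \<forall>b\<in>I. a + b \<in> I) \<and> (\<forall>r\<in>C. \<forall>a\<in>I. r * a \<in> I)"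

lemma ideal_in_zero: "ideal_in {0}"
  by (auto simp: ideal_in_def)

context
  fixes I assumes I: "ideal_in I"
begin

lemma ideal_in_subset: "a \<in> I \<Longrightarrow> a \<in> C"
  and ideal_in_0: "0 \<in> I"
  and ideal_in_add: "a \<in> I \<Longrightarrow> b \<in> I \<Longrightarrow> a + b \<in> I"
  and ideal_in_mult: "r \<in> C \<Longrightarrow> a \<in> I \<Longrightarrow> r * a \<in> I"
  using I by (auto simp: ideal_in_def)

lemma ideal_in_mult_right: "r \<in> C \<Longrightarrow> a \<in> I \<Longrightarrow> a * r \<in> I"
  using ideal_in_mult[of r a] by (simp add: mult.commute)

lemma ideal_in_uminus: "a \<in> I \<Longrightarrow> - a \<in> I"
  using ideal_in_mult[of "-1" a] by auto

lemma ideal_in_diff: "a \<in> I \<Longrightarrow> b \<in> I \<Longrightarrow> a - b \<in> I"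
  using ideal_in_add[of a "- b"] ideal_in_uminus by auto

lemma ideal_in_sum: "(\<And>x. x \<in> A \<Longrightarrow> h x \<in> I) \<Longrightarrow> sum h A \<in> I"
  by (induction A rule: infinite_finite_induct) (auto simp: ideal_in_0 ideal_in_add)

lemma ideal_in_cong: "a - b \<in> I \<Longrightarrow> a \<in> I \<longleftrightarrow> b \<in> I"
  using ideal_in_add[of "a - b" b] ideal_in_diff[of a "a - b"] by auto

end

text \<open>
  The ideal generated by \<open>I\<close> and \<open>a\<close>. Adding one generator at a time matches the way in which regular
  sequences are tested.
\<close>

definition adjoin :: "'b set \<Rightarrow> 'b \<Rightarrow> 'b set" where
  "adjoin I a = {i + r * a | i r. i \<in> I \<and> r \<in> C}"

lemma adjoinI: "i \<in> I \<Longrightarrow> r \<in> C \<Longrightarrow> i + r * a \<in> adjoin I a"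
  by (auto simp: adjoin_def)

lemma adjoin_iff: "x \<in> adjoin I a \<longleftrightarrow> (\<exists>r\<in>C. x - r * a \<in> I)"
proof
  assume "\<exists>r\<in>C. x - r * a \<in> I"
  then obtain r where "r \<in> C" "x - r * a \<in> I" by blast
  then show "x \<in> adjoin I a" using adjoinI[of "x - r * a" I r a] by simp
next
  assume "x \<in> adjoin I a"
  then obtain i r where "x = i + r * a" "i \<in> I" "r \<in> C" by (auto simp: adjoin_def)
  then show "\<exists>r\<in>C. x - r * a \<in> I" by (intro bexI[of _ r]) simp_all
qed

lemma subset_adjoin: "x \<in> I \<Longrightarrow> x \<in> adjoin I a"
  using adjoinI[of x I 0 a] by simp

lemma self_in_adjoin: "0 \<in> I \<Longrightarrow> a \<in> adjoin I a"
  using adjoinI[of 0 I 1 a] by simp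

lemma ideal_in_adjoin:
  assumes "ideal_in I" "a \<in> C"
  shows "ideal_in (adjoin I a)"
  unfolding ideal_in_def
proof (intro conjI ballI subsetI)
  show "0 \<in> adjoin I a" using assms subset_adjoin ideal_in_0 by blast
next
  fix x assume "x \<in> adjoin I a"
  then show "x \<in> C" using assms ideal_in_subset by (auto simp: adjoin_def)
next
  fix x y assume "x \<in> adjoin I a" "y \<in> adjoin I a"
  then obtain r s where "r \<in> C" "s \<in> C" "x - r * a \<in> I" "y - s * a \<in> I"
    by (auto simp: adjoin_iff)
  then have "r + s \<in> C" "(x + y) - (r + s) * a \<in> I"
    using ideal_in_add[OF assms(1), of "x - r * a" "y - s * a"] by (auto simp: algebra_simps)
  then show "x + y \<in> adjoin I a" by (auto simp: adjoin_iff)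
next
  fix s x assume "s \<in> C" "x \<in> adjoin I a"
  then obtain r where "r \<in> C" "x - r * a \<in> I"
    by (auto simp: adjoin_iff)
  then have "s * r \<in> C" "s * x - (s * r) * a \<in> I"
    using ideal_in_mult[OF assms(1), of s "x - r * a"] \<open>s \<in> C\<close> by (auto simp: algebra_simps)
  then show "s * x \<in> adjoin I a" by (auto simp: adjoin_iff)
qed

lemma adjoin_least:
  assumes "ideal_in J" "I \<subseteq> J" "a \<in> J"
  shows "adjoin I a \<subseteq> J"
  using assms by (auto simp: adjoin_def intro!: ideal_in_add[OF assms(1)] ideal_in_mult[OF assms(1)])

lemma adjoin_commute: "adjoin (adjoin I a) b = adjoin (adjoin I b) a"
proof -
  have "x - r * b - s * a = x - s * a - r * b" for x r s by simp
  then show ?thesis unfolding adjoin_iff set_eq_iff by (simp only:) blast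
qed

lemma adjoin_mult_subset: "ideal_in I \<Longrightarrow> u \<in> C \<Longrightarrow> v \<in> C \<Longrightarrow> adjoin I (u * v) \<subseteq> adjoin I u"
  by (rule adjoin_least)
    (auto intro: ideal_in_adjoin subset_adjoin ideal_in_mult_right ideal_in_mult self_in_adjoin ideal_in_0)

definition adjoin_list :: "'b set \<Rightarrow> 'b list \<Rightarrow> 'b set" where
  "adjoin_list I fs = foldl adjoin I fs"

lemma adjoin_list_simps [simp]:
  "adjoin_list I [] = I"
  "adjoin_list I (a # fs) = adjoin_list (adjoin I a) fs"
  "adjoin_list I (fs @ gs) = adjoin_list (adjoin_list I fs) gs"
  by (simp_all add: adjoin_list_def)

lemma ideal_in_adjoin_list: "ideal_in I \<Longrightarrow> set fs \<subseteq> C \<Longrightarrow> ideal_in (adjoin_list I fs)"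
  by (induction fs arbitrary: I) (auto simp: ideal_in_adjoin)

lemma subset_adjoin_list: "I \<subseteq> adjoin_list I fs"
proof (induction fs arbitrary: I)
  case (Cons a fs)
  then show ?case using subset_adjoin[of _ I a] by fastforce
qed simp

lemma set_subset_adjoin_list: "0 \<in> I \<Longrightarrow> set fs \<subseteq> adjoin_list I fs"
proof (induction fs arbitrary: I)
  case (Cons a fs)
  then show ?case
    using subset_adjoin_list[of "adjoin I a" fs] self_in_adjoin[of I a] subset_adjoin[of 0 I a]
    by auto
qed simp

lemma adjoin_list_least:
  "ideal_in J \<Longrightarrow> I \<subseteq> J \<Longrightarrow> set fs \<subseteq> J \<Longrightarrow> adjoin_list I fs \<subseteq> J"
  by (induction fs arbitrary: I) (auto simp: adjoin_least)

lemma adjoin_list_adjoin_commute: "adjoin_list (adjoin I a) fs = adjoin (adjoin_list I fs) a"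
proof (induction fs arbitrary: I)
  case (Cons b fs)
  then show ?case by (simp add: adjoin_commute[of I a b])
qed simp

definition nonzerodivisor_mod :: "'b set \<Rightarrow> 'b \<Rightarrow> bool" where
  "nonzerodivisor_mod I a \<longleftrightarrow> (\<forall>h\<in>C. h * a \<in> I \<longrightarrow> h \<in> I)"

primrec regular_list :: "'b set \<Rightarrow> 'b list \<Rightarrow> bool" where
  "regular_list I [] \<longleftrightarrow> True"
| "regular_list I (a # fs) \<longleftrightarrow> nonzerodivisor_mod I a \<and> regular_list (adjoin I a) fs"

lemma regular_list_append:
  "regular_list I (fs @ gs) \<longleftrightarrow> regular_list I fs \<and> regular_list (adjoin_list I fs) gs"
  by (induction fs arbitrary: I) auto

lemma regular_list_map_upt:
  "regular_list I (map f [1..<Suc n]) \<longleftrightarrow>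
     (\<forall>k\<in>{1..n}. nonzerodivisor_mod (adjoin_list I (map f [1..<k])) (f k))"
proof (induction n)
  case (Suc n)
  have "map f [1..<Suc (Suc n)] = map f [1..<Suc n] @ [f (Suc n)]" by simp
  then show ?case
    using Suc by (simp only: regular_list_append atLeastAtMostSuc_conv) auto
qed simp

lemma nonzerodivisor_mod_mult:
  assumes "u \<in> C" "v \<in> C" "ideal_in I"
  shows "nonzerodivisor_mod I (u * v) \<longleftrightarrow> nonzerodivisor_mod I u \<and> nonzerodivisor_mod I v"
proof (intro iffI conjI)
  assume uv: "nonzerodivisor_mod I (u * v)"
  show "nonzerodivisor_mod I u" unfolding nonzerodivisor_mod_def
  proof (intro ballI impI)
    fix h assume "h \<in> C" "h * u \<in> I"
    then have "h * (u * v) \<in> I"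
      using assms ideal_in_mult_right[of I v "h * u"] by (simp add: mult.assoc)
    with uv \<open>h \<in> C\<close> show "h \<in> I" by (simp add: nonzerodivisor_mod_def)
  qed
  show "nonzerodivisor_mod I v" unfolding nonzerodivisor_mod_def
  proof (intro ballI impI)
    fix h assume "h \<in> C" "h * v \<in> I"
    then have "h * (u * v) \<in> I"
      using assms ideal_in_mult[of I u "h * v"] by (simp add: ac_simps)
    with uv \<open>h \<in> C\<close> show "h \<in> I" by (simp add: nonzerodivisor_mod_def)
  qed
next
  assume "nonzerodivisor_mod I u \<and> nonzerodivisor_mod I v"
  then show "nonzerodivisor_mod I (u * v)"
    using assms by (auto simp: nonzerodivisor_mod_def mult.assoc[symmetric])
qed

text \<open>
  One half of the exchange of two neighbours in a regular sequence. The other half,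
  that \<open>f\<close> is a nonzerodivisor modulo \<open>I\<close>, would need a grading.
\<close>

lemma nonzerodivisor_mod_swap:
  assumes "w \<in> C" "f \<in> C" "ideal_in I"
    and w: "nonzerodivisor_mod I w" and f: "nonzerodivisor_mod (adjoin I w) f"
  shows "nonzerodivisor_mod (adjoin I f) w"
  unfolding nonzerodivisor_mod_def
proof (intro ballI impI)
  fix h assume h: "h \<in> C" "h * w \<in> adjoin I f"
  then obtain r where r: "r \<in> C" "h * w - r * f \<in> I" by (auto simp: adjoin_iff)
  have "r * f - h * w \<in> I" using ideal_in_uminus[OF assms(3) r(2)] by simp
  then have "r * f \<in> adjoin I w" using h(1) by (auto simp: adjoin_iff)
  then have "r \<in> adjoin I w" using f r(1) by (simp add: nonzerodivisor_mod_def)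
  then obtain s where s: "s \<in> C" "r - s * w \<in> I" by (auto simp: adjoin_iff)
  have "f * (r - s * w) \<in> I" using assms s ideal_in_mult by blast
  then have "(h * w - r * f) + f * (r - s * w) \<in> I" using r ideal_in_add assms(3) by blast
  then have "(h - s * f) * w \<in> I" by (simp add: algebra_simps)
  then have "h - s * f \<in> I" using w h(1) s(1) assms(2) by (auto simp: nonzerodivisor_mod_def)
  then show "h \<in> adjoin I f" using s(1) by (auto simp: adjoin_iff)
qed

lemma regular_list_Cons_imp_nonzerodivisor:
  assumes "w \<in> C" "set fs \<subseteq> C" "ideal_in I" "regular_list I (w # fs)"
  shows "nonzerodivisor_mod (adjoin_list I fs) w"
  using assms
proof (induction fs arbitrary: I)
  case (Cons f fs)
  have "nonzerodivisor_mod (adjoin I f) w"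
    using nonzerodivisor_mod_swap[of w f I] Cons.prems by simp
  moreover have "regular_list (adjoin (adjoin I f) w) fs"
    using Cons.prems by (simp add: adjoin_commute)
  ultimately show ?case
    using Cons.prems Cons.IH[of "adjoin I f"] by (simp add: ideal_in_adjoin)
qed simp

lemma regular_list_whole: "C \<subseteq> I \<Longrightarrow> regular_list I fs"
proof (induction fs arbitrary: I)
  case (Cons a fs)
  have "regular_list (adjoin I a) fs"
    using Cons.prems subset_adjoin[of _ I a] by (intro Cons.IH) auto
  then show ?case using Cons.prems by (auto simp: nonzerodivisor_mod_def)
qed simp

text \<open>
  Here \<open>R / (I, u)\<close> embeds into \<open>R / (I, u * v)\<close> by multiplication with \<open>v\<close>, with cokernel
  \<open>R / (I, v)\<close>. So an element that is regular on the middle term is regular on the two ends (by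
  the symmetry of \<open>u\<close> and \<open>v\<close>), and conversely.
\<close>

lemma nonzerodivisor_mod_adjoin_mult:
  assumes C: "u \<in> C" "v \<in> C" "f \<in> C" and I: "ideal_in I"
    and uv: "nonzerodivisor_mod I u" "nonzerodivisor_mod I v"
  shows "nonzerodivisor_mod (adjoin I (u * v)) f \<longleftrightarrow>
    nonzerodivisor_mod (adjoin I u) f \<and> nonzerodivisor_mod (adjoin I v) f"
proof -
  have left: "nonzerodivisor_mod (adjoin I u) f"
    if C': "u \<in> C" "v \<in> C" and nzd: "nonzerodivisor_mod I v"
      and f: "nonzerodivisor_mod (adjoin I (u * v)) f" for u v
    unfolding nonzerodivisor_mod_def
  proof (intro ballI impI)
    fix h assume h: "h \<in> C" "h * f \<in> adjoin I u"
    then obtain r where r: "r \<in> C" "h * f - r * u \<in> I" by (auto simp: adjoin_iff)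
    have "v * (h * f - r * u) \<in> I" using I C' r ideal_in_mult by blast
    then have "(v * h) * f \<in> adjoin I (u * v)"
      using r(1) by (auto simp: adjoin_iff algebra_simps)
    then have "v * h \<in> adjoin I (u * v)" using f C' h(1) by (auto simp: nonzerodivisor_mod_def)
    then obtain s where s: "s \<in> C" "v * h - s * (u * v) \<in> I" by (auto simp: adjoin_iff)
    have "(h - s * u) * v \<in> I" using s by (simp add: algebra_simps)
    then have "h - s * u \<in> I" using nzd h C' s by (auto simp: nonzerodivisor_mod_def)
    then show "h \<in> adjoin I u" using s(1) by (auto simp: adjoin_iff)
  qed
  have "nonzerodivisor_mod (adjoin I (u * v)) f"
    if fu: "nonzerodivisor_mod (adjoin I u) f" and fv: "nonzerodivisor_mod (adjoin I v) f"
    unfolding nonzerodivisor_mod_def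
  proof (intro ballI impI)
    fix h assume h: "h \<in> C" "h * f \<in> adjoin I (u * v)"
    then obtain r where r: "r \<in> C" "h * f - r * (u * v) \<in> I" by (auto simp: adjoin_iff)
    have "h * f \<in> adjoin I u" using h(2) adjoin_mult_subset[OF I C(1,2)] by blast
    then have "h \<in> adjoin I u" using fu h(1) by (simp add: nonzerodivisor_mod_def)
    then obtain s where s: "s \<in> C" "h - s * u \<in> I" by (auto simp: adjoin_iff)
    have "f * (h - s * u) \<in> I" using s C I ideal_in_mult by blast
    then have "(h * f - r * (u * v)) - f * (h - s * u) \<in> I" using r ideal_in_diff I by blast
    then have "(s * f - r * v) * u \<in> I" by (simp add: algebra_simps)
    then have "s * f - r * v \<in> I" using uv r s C by (auto simp: nonzerodivisor_mod_def)
    then have "s * f \<in> adjoin I v" using r by (auto simp: adjoin_iff)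
    then have "s \<in> adjoin I v" using fv s by (simp add: nonzerodivisor_mod_def)
    then obtain t where t: "t \<in> C" "s - t * v \<in> I" by (auto simp: adjoin_iff)
    have "u * (s - t * v) \<in> I" using t C I ideal_in_mult by blast
    then have "(h - s * u) + u * (s - t * v) \<in> I" using s ideal_in_add I by blast
    then have "h - t * (u * v) \<in> I" by (simp add: algebra_simps)
    then show "h \<in> adjoin I (u * v)" using t by (auto simp: adjoin_iff)
  qed
  then show ?thesis using left[of u v] left[of v u] C uv by (auto simp: mult.commute)
qed

text \<open>
  The entries behind \<open>u * v\<close> are adjoined to \<open>I\<close> one by one; swapping keeps \<open>u\<close> and \<open>v\<close>
  nonzerodivisors modulo the growing ideal, so that the previous lemma applies at each step.
\<close>

lemma regular_list_mult_Cons: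
  assumes "u \<in> C" "v \<in> C" "set fs \<subseteq> C" "ideal_in I"
  shows "regular_list I (u * v # fs) \<longleftrightarrow> regular_list I (u # fs) \<and> regular_list I (v # fs)"
proof -
  have "regular_list (adjoin I (u * v)) fs \<longleftrightarrow>
        regular_list (adjoin I u) fs \<and> regular_list (adjoin I v) fs"
    if "nonzerodivisor_mod I u" "nonzerodivisor_mod I v"
    using assms(3,4) that
  proof (induction fs arbitrary: I)
    case (Cons f fs)
    have *: "nonzerodivisor_mod (adjoin I (u * v)) f \<longleftrightarrow>
        nonzerodivisor_mod (adjoin I u) f \<and> nonzerodivisor_mod (adjoin I v) f"
      using Cons.prems assms nonzerodivisor_mod_adjoin_mult[of u v f I] by simp
    show ?case
    proof (cases "nonzerodivisor_mod (adjoin I (u * v)) f")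
      case True
      then have "nonzerodivisor_mod (adjoin I f) u" "nonzerodivisor_mod (adjoin I f) v"
        using * Cons.prems assms nonzerodivisor_mod_swap[of u f I] nonzerodivisor_mod_swap[of v f I] by simp_all
      then have "regular_list (adjoin (adjoin I f) (u * v)) fs \<longleftrightarrow>
          regular_list (adjoin (adjoin I f) u) fs \<and> regular_list (adjoin (adjoin I f) v) fs"
        using Cons.prems by (intro Cons.IH) (auto simp: ideal_in_adjoin)
      then show ?thesis using * by (simp add: adjoin_commute[of I f]) blast
    qed (use * in auto)
  qed simp
  then show ?thesis using nonzerodivisor_mod_mult[OF assms(1,2,4)] by auto
qed

text \<open>
  For an empty product both sides hold: modulo the unit ideal everything is regular.
\<close>

lemma regular_list_prod_list_Cons:
  assumes "set us \<subseteq> C" "set fs \<subseteq> C" "ideal_in I"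
  shows "regular_list I (prod_list us # fs) \<longleftrightarrow> (\<forall>u\<in>set us. regular_list I (u # fs))"
  using assms(1)
proof (induction us)
  case Nil
  have "C \<subseteq> adjoin I 1"
    using ideal_in_0[OF assms(3)] adjoinI[of 0 I _ 1] by auto
  then show ?case by (auto simp: nonzerodivisor_mod_def regular_list_whole)
next
  case (Cons u us)
  then show ?case
    using regular_list_mult_Cons[of u "prod_list us" fs I] assms prod_list_mem by auto
qed

theorem regular_list_map_prod_list:
  assumes "\<Union>(set ` set Us) \<subseteq> C" "[] \<notin> set Us" "ideal_in I"
  shows "regular_list I (map prod_list Us) \<longleftrightarrow>
    (\<forall>t. list_all2 (\<lambda>u us. u \<in> set us) t Us \<longrightarrow> regular_list I t)"
  using assms
proof (induction Us arbitrary: I)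
  case (Cons us Us)
  have C: "set us \<subseteq> C" "set (map prod_list Us) \<subseteq> C"
    using Cons.prems(1) by (auto intro!: prod_list_mem)
  have IH: "regular_list (adjoin I u) (map prod_list Us) \<longleftrightarrow>
      (\<forall>t. list_all2 (\<lambda>u us. u \<in> set us) t Us \<longrightarrow> regular_list (adjoin I u) t)"
    if "u \<in> set us" for u
    using that C Cons.prems by (intro Cons.IH ideal_in_adjoin) auto
  \<comment> \<open>Some choice exists, which is what makes the condition on the first entry visible.\<close>
  have ex: "list_all2 (\<lambda>u us. u \<in> set us) (map hd Us) Us"
    using Cons.prems(2) by (induction Us) auto
  have "regular_list I (map prod_list (us # Us)) \<longleftrightarrow>
      (\<forall>u\<in>set us. regular_list I (u # map prod_list Us))"
    using C Cons.prems(3) by (simp only: list.map regular_list_prod_list_Cons)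
  also have "\<dots> \<longleftrightarrow> (\<forall>u\<in>set us. nonzerodivisor_mod I u \<and>
      (\<forall>t. list_all2 (\<lambda>u us. u \<in> set us) t Us \<longrightarrow> regular_list (adjoin I u) t))"
    using IH by simp
  also have "\<dots> \<longleftrightarrow> (\<forall>t. list_all2 (\<lambda>u us. u \<in> set us) t (us # Us) \<longrightarrow> regular_list I t)"
  proof safe
    fix t assume *: "\<forall>u\<in>set us. nonzerodivisor_mod I u \<and>
      (\<forall>t. list_all2 (\<lambda>u us. u \<in> set us) t Us \<longrightarrow> regular_list (adjoin I u) t)"
      and "list_all2 (\<lambda>u us. u \<in> set us) t (us # Us)"
    then show "regular_list I t" by (auto simp: list_all2_Cons2)
  next
    fix u t assume *: "\<forall>t. list_all2 (\<lambda>u us. u \<in> set us) t (us # Us) \<longrightarrow> regular_list I t"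
      and u: "u \<in> set us"
    have reg: "regular_list I (u # t)" if "list_all2 (\<lambda>u us. u \<in> set us) t Us" for t
      using * u that by (simp del: regular_list.simps)
    from reg[OF ex] show "nonzerodivisor_mod I u" by simp
    show "regular_list (adjoin I u) t" if "list_all2 (\<lambda>u us. u \<in> set us) t Us"
      using reg[OF that] by simp
  qed
  finally show ?case .
qed simp

text \<open>
  If the products form a regular list, then modulo \<open>I\<close> the colon ideal of
  \<open>(u\<^sub>1 * v\<^sub>1, \<dots>, u\<^sub>k * v\<^sub>k)\<close> by \<open>u\<^sub>1 * \<dots> * u\<^sub>k\<close> lies in \<open>(v\<^sub>1, \<dots>, v\<^sub>k)\<close>. Each
  \<open>u\<^sub>i\<close> is cancelled in turn, as it is a nonzerodivisor modulo the other products. For \<open>h = 1\<close> this shows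
  that the product of the \<open>u\<^sub>i\<close> is nonzero modulo the \<open>u\<^sub>i * v\<^sub>i\<close> if the \<open>v\<^sub>i\<close> generate a proper ideal.
\<close>

lemma mult_prod_in_adjoin_list_imp:
  assumes "\<forall>(u, v) \<in> set ps. u \<in> C \<and> v \<in> C" "ideal_in I" "h \<in> C"
    and "regular_list I (map (\<lambda>(u, v). u * v) ps)"
    and "h * prod_list (map fst ps) \<in> adjoin_list I (map (\<lambda>(u, v). u * v) ps)"
  shows "h \<in> adjoin_list I (map snd ps)"
  using assms
proof (induction ps arbitrary: I)
  case (Cons p ps)
  obtain u v where p: "p = (u, v)" by (cases p)
  define U where "U = prod_list (map fst ps)"
  define fs where "fs = map (\<lambda>(u, v). u * v) ps"
  have C: "u \<in> C" "v \<in> C" "U \<in> C" "set fs \<subseteq> C"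
    using Cons.prems(1) by (fastforce simp: p U_def fs_def intro!: prod_list_mem)+
  have I: "ideal_in (adjoin_list I fs)" using C Cons.prems ideal_in_adjoin_list by blast
  have reg: "regular_list I (u # fs)" "regular_list I (v # fs)"
    using Cons.prems(2,4) C regular_list_mult_Cons[of u v fs I] by (auto simp: p fs_def)
  have "h * (u * U) \<in> adjoin (adjoin_list I fs) (u * v)"
    using Cons.prems(5) by (simp add: p fs_def U_def adjoin_list_adjoin_commute)
  then obtain r where r: "r \<in> C" "h * (u * U) - r * (u * v) \<in> adjoin_list I fs"
    by (auto simp: adjoin_iff)
  then have "(h * U - r * v) * u \<in> adjoin_list I fs" by (simp add: algebra_simps)
  moreover have "nonzerodivisor_mod (adjoin_list I fs) u"
    using C Cons.prems(2) reg by (rule_tac regular_list_Cons_imp_nonzerodivisor)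
  ultimately have "h * U - r * v \<in> adjoin_list I fs"
    using C r \<open>h \<in> C\<close> by (auto simp: nonzerodivisor_mod_def)
  then have "h * U \<in> adjoin_list (adjoin I v) fs"
    using r by (auto simp: adjoin_list_adjoin_commute adjoin_iff)
  then show ?case
    using Cons.prems Cons.IH[of "adjoin I v"] reg(2) C
    by (auto simp: p U_def fs_def ideal_in_adjoin)
qed simp

end

section \<open>Polynomials, substitution and linear forms\<close>

abbreviation polys :: "nat \<Rightarrow> 'a::field mpoly set" where
  "polys n \<equiv> carrier (mpoly_ring n)"

lemma mpoly_ring_simps [simp]:
  "monoid.mult (mpoly_ring n) = (*)" "monoid.one (mpoly_ring n) = 1"
  "ring.zero (mpoly_ring n) = 0" "ring.add (mpoly_ring n) = (+)"
  by (simp_all add: mpoly_ring_def)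

lemma polys_iff: "p \<in> polys n \<longleftrightarrow> (\<forall>t\<in>Poly_Mapping.keys p. Poly_Mapping.keys t \<subseteq> {1..n})"
  by (simp add: mpoly_ring_def)

lemma polys_indexD:
  "p \<in> polys n \<Longrightarrow> t \<in> Poly_Mapping.keys p \<Longrightarrow> i \<in> Poly_Mapping.keys t \<Longrightarrow> i \<in> {1..n}"
  unfolding polys_iff by blast

lemma unital_subring_polys: "unital_subring (polys n :: 'a::field mpoly set)"
proof -
  interpret cring "mpoly_ring n :: 'a mpoly ring" by (rule cring_mpoly_ring)
  show ?thesis
  proof
    show "- p \<in> polys n" if "p \<in> polys n" for p :: "'a mpoly"
      using that by (simp add: polys_iff)
  qed (use zero_closed one_closed a_closed m_closed in simp_all)
qed

interpretation poly: unital_subring "polys n :: 'a::field mpoly set" for n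
  by (rule unital_subring_polys)

definition var :: "nat \<Rightarrow> 'a::field mpoly" where
  "var k = Poly_Mapping.single (Poly_Mapping.single k 1) 1"

lemma const_poly_mem [simp]: "const_poly c \<in> polys n"
  by (simp add: polys_iff)

lemma var_mem: "k \<in> {1..n} \<Longrightarrow> var k \<in> polys n"
  by (simp add: polys_iff var_def)

lemma const_poly_mult: "const_poly a * const_poly b = const_poly (a * b)"
  by (simp add: mult_single)

lemma const_poly_sum: "const_poly (sum h A) = (\<Sum>x\<in>A. const_poly (h x))"
  by (induction A rule: infinite_finite_induct) (auto simp: single_add)

lemma lookup_const_poly_mult [simp]:
  "Poly_Mapping.lookup (const_poly c * p) t = c * Poly_Mapping.lookup p t"
  unfolding mult_map_scale_conv_mult[symmetric] by transfer (simp add: when_def)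

lemma poly_as_sum_of_monomials:
  fixes p :: "'b \<Rightarrow>\<^sub>0 'c::comm_monoid_add"
  shows "p = (\<Sum>t\<in>Poly_Mapping.keys p. Poly_Mapping.single t (Poly_Mapping.lookup p t))"
proof (rule poly_mapping_eqI)
  fix t
  show "Poly_Mapping.lookup p t = Poly_Mapping.lookup
    (\<Sum>t\<in>Poly_Mapping.keys p. Poly_Mapping.single t (Poly_Mapping.lookup p t)) t"
    by (auto simp: lookup_sum lookup_single when_def in_keys_iff)
qed

definition monomial_value :: "(nat \<Rightarrow> 'a mpoly) \<Rightarrow> (nat \<Rightarrow>\<^sub>0 nat) \<Rightarrow> 'a::field mpoly" where
  "monomial_value \<theta> t = (\<Prod>i\<in>Poly_Mapping.keys t. \<theta> i ^ Poly_Mapping.lookup t i)"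

lemma monomial_value_superset:
  assumes "finite A" "Poly_Mapping.keys t \<subseteq> A"
  shows "monomial_value \<theta> t = (\<Prod>i\<in>A. \<theta> i ^ Poly_Mapping.lookup t i)"
  unfolding monomial_value_def using assms
  by (intro prod.mono_neutral_left) (auto simp: in_keys_iff)

lemma monomial_value_add:
  "monomial_value \<theta> (s + t) = monomial_value \<theta> s * monomial_value \<theta> t"
  using keys_add[of s t] monomial_value_superset[of "Poly_Mapping.keys s \<union> Poly_Mapping.keys t" _ \<theta>]
  by (simp add: lookup_add power_add prod.distrib)

definition subst :: "(nat \<Rightarrow> 'a mpoly) \<Rightarrow> 'a mpoly \<Rightarrow> 'a::field mpoly" where
  "subst \<theta> p =
     (\<Sum>t\<in>Poly_Mapping.keys p. const_poly (Poly_Mapping.lookup p t) * monomial_value \<theta> t)"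

lemma subst_superset:
  assumes "finite A" "Poly_Mapping.keys p \<subseteq> A"
  shows "subst \<theta> p = (\<Sum>t\<in>A. const_poly (Poly_Mapping.lookup p t) * monomial_value \<theta> t)"
  unfolding subst_def using assms
  by (intro sum.mono_neutral_left) (auto simp: in_keys_iff)

lemma subst_add: "subst \<theta> (p + q) = subst \<theta> p + subst \<theta> q"
  using keys_add[of p q] subst_superset[of "Poly_Mapping.keys p \<union> Poly_Mapping.keys q" _ \<theta>]
  by (simp add: lookup_add single_add distrib_right sum.distrib)

lemma subst_0 [simp]: "subst \<theta> 0 = 0"
  by (simp add: subst_def)

lemma subst_sum: "subst \<theta> (sum h A) = (\<Sum>x\<in>A. subst \<theta> (h x))"
  by (induction A rule: infinite_finite_induct) (auto simp: subst_add)

lemma subst_single: "subst \<theta> (Poly_Mapping.single t c) = const_poly c * monomial_value \<theta> t"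
  by (cases "c = 0") (simp_all add: subst_def)

lemma subst_const_poly [simp]: "subst \<theta> (const_poly c) = const_poly c"
  by (simp add: subst_single monomial_value_def)

lemma subst_1 [simp]: "subst \<theta> 1 = 1"
  using subst_const_poly[of \<theta> 1] by simp

lemma subst_var [simp]: "subst \<theta> (var k) = \<theta> k"
  by (simp add: var_def subst_single monomial_value_def)

lemma monomial_value_var: "monomial_value var t = Poly_Mapping.single t 1"
proof -
  have pow: "var i ^ k = Poly_Mapping.single (Poly_Mapping.single i k) (1::'a)" for i k
    by (induction k) (simp_all add: var_def mult_single flip: single_add)
  have "(\<Prod>i\<in>A. Poly_Mapping.single (g i) 1) = Poly_Mapping.single (sum g A) (1::'a)"
    for A and g :: "nat \<Rightarrow> nat \<Rightarrow>\<^sub>0 nat"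
    by (induction A rule: infinite_finite_induct) (simp_all add: mult_single)
  then show ?thesis
    unfolding monomial_value_def pow by (simp only: poly_as_sum_of_monomials[symmetric])
qed

lemma subst_var_id: "subst var p = p"
proof -
  have "subst var p = (\<Sum>t\<in>Poly_Mapping.keys p. Poly_Mapping.single t (Poly_Mapping.lookup p t))"
    unfolding subst_def monomial_value_var by (simp add: mult_single)
  then show ?thesis by (simp only: poly_as_sum_of_monomials[symmetric])
qed

text \<open>
  Every polynomial is its own value under the substitution of the variables for themselves, hence
  built from constants and variables by sums and products.
\<close>

lemma polys_induct [consumes 1, case_names const var add mult]:
  assumes "p \<in> polys n"
    and const: "\<And>c. Q (const_poly c)"
    and var: "\<And>k. k \<in> {1..n} \<Longrightarrow> Q (var k)"
    and add: "\<And>p q. p \<in> polys n \<Longrightarrow> q \<in> polys n \<Longrightarrow> Q p \<Longrightarrow> Q q \<Longrightarrow> Q (p + q)"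
    and mult: "\<And>p q. p \<in> polys n \<Longrightarrow> q \<in> polys n \<Longrightarrow> Q p \<Longrightarrow> Q q \<Longrightarrow> Q (p * q)"
  shows "Q p"
proof -
  let ?Q = "\<lambda>p. p \<in> polys n \<and> Q p"
  have const': "?Q (const_poly c)" for c using const by simp
  have mult': "?Q p \<Longrightarrow> ?Q q \<Longrightarrow> ?Q (p * q)" for p q using mult by auto
  have pow: "?Q p \<Longrightarrow> ?Q (p ^ k)" for p k
    by (induction k) (use const'[of 1] mult' in auto)
  have prod: "(\<And>x. x \<in> A \<Longrightarrow> ?Q (h x)) \<Longrightarrow> ?Q (prod h A)" for h and A :: "nat set"
    by (induction A rule: infinite_finite_induct) (use const'[of 1] mult' in auto)
  have sum: "(\<And>x. x \<in> A \<Longrightarrow> ?Q (h x)) \<Longrightarrow> ?Q (sum h A)" for h and A :: "(nat \<Rightarrow>\<^sub>0 nat) set"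
    by (induction A rule: infinite_finite_induct) (use const'[of 0] add in auto)
  have "?Q (subst var p)"
    unfolding subst_def monomial_value_def
    using polys_indexD[OF assms(1)] var var_mem by (intro sum mult' const' prod pow) blast+
  then show ?thesis by (simp add: subst_var_id)
qed

lemma subst_mult: "subst \<theta> (p * q) = subst \<theta> p * subst \<theta> q"
proof -
  let ?m = "\<lambda>p t. Poly_Mapping.single t (Poly_Mapping.lookup p t)"
  have "p * q = (\<Sum>s\<in>Poly_Mapping.keys p. \<Sum>t\<in>Poly_Mapping.keys q. ?m p s * ?m q t)"
    by (simp only: sum_product[symmetric] poly_as_sum_of_monomials[symmetric])
  moreover have "subst \<theta> (?m p s * ?m q t) = subst \<theta> (?m p s) * subst \<theta> (?m q t)" for s t
    by (simp only: mult_single subst_single monomial_value_add const_poly_mult[symmetric] ac_simps)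
  ultimately have "subst \<theta> (p * q) =
      (\<Sum>s\<in>Poly_Mapping.keys p. \<Sum>t\<in>Poly_Mapping.keys q. subst \<theta> (?m p s) * subst \<theta> (?m q t))"
    by (simp only: subst_sum)
  also have "\<dots> = subst \<theta> (\<Sum>s\<in>Poly_Mapping.keys p. ?m p s) * subst \<theta> (\<Sum>t\<in>Poly_Mapping.keys q. ?m q t)"
    by (simp only: subst_sum sum_product)
  finally show ?thesis by (simp only: poly_as_sum_of_monomials[symmetric])
qed

lemma subst_prod: "subst \<theta> (prod h A) = (\<Prod>x\<in>A. subst \<theta> (h x))"
  by (induction A rule: infinite_finite_induct) (auto simp: subst_mult)

lemma monom_degree_superset:
  assumes "finite A" "Poly_Mapping.keys t \<subseteq> A"
  shows "monom_degree t = (\<Sum>i\<in>A. Poly_Mapping.lookup t i)"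
  unfolding monom_degree_def using assms
  by (intro sum.mono_neutral_left) (auto simp: in_keys_iff)

lemma monom_degree_add: "monom_degree (s + t) = monom_degree s + monom_degree t"
  using keys_add[of s t] monom_degree_superset[of "Poly_Mapping.keys s \<union> Poly_Mapping.keys t"]
  by (simp add: lookup_add sum.distrib)

lemma forms_subset: "p \<in> forms n d \<Longrightarrow> p \<in> polys n"
  by (simp add: forms_def)

lemma forms_0 [simp]: "0 \<in> forms n d"
  by (simp add: forms_def)

lemma forms_add: "p \<in> forms n d \<Longrightarrow> q \<in> forms n d \<Longrightarrow> p + q \<in> forms n d"
  using keys_add[of p q] by (auto simp: forms_def)

lemma forms_sum: "(\<And>x. x \<in> A \<Longrightarrow> h x \<in> forms n d) \<Longrightarrow> sum h A \<in> forms n d"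
  by (induction A rule: infinite_finite_induct) (auto simp: forms_add)

lemma forms_mult: "p \<in> forms n d \<Longrightarrow> q \<in> forms n e \<Longrightarrow> p * q \<in> forms n (d + e)"
  using keys_mult[of p q] by (fastforce simp: forms_def monom_degree_add)

lemma forms_const_poly: "const_poly c \<in> forms n 0"
  by (simp add: forms_def monom_degree_def)

lemma forms_const_mult: "p \<in> forms n d \<Longrightarrow> const_poly c * p \<in> forms n d"
  using forms_mult[OF forms_const_poly] by fastforce

lemma forms_uminus: "p \<in> forms n d \<Longrightarrow> - p \<in> forms n d"
  by (auto simp: forms_def)

lemma forms_diff: "p \<in> forms n d \<Longrightarrow> q \<in> forms n d \<Longrightarrow> p - q \<in> forms n d"
  using forms_add[of p n d "- q"] forms_uminus by auto

lemma forms_var: "k \<in> {1..n} \<Longrightarrow> var k \<in> forms n 1"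
  by (simp add: forms_def var_mem) (simp add: var_def monom_degree_def)

lemma forms_prod: "(\<And>x. x \<in> A \<Longrightarrow> h x \<in> forms n (d x)) \<Longrightarrow> prod h A \<in> forms n (sum d A)"
proof (induction A rule: infinite_finite_induct)
  case (insert x A)
  then show ?case using forms_mult[of "h x" n "d x"] by auto
qed (use forms_const_poly[of 1] in auto)

lemma forms_power: "p \<in> forms n d \<Longrightarrow> p ^ k \<in> forms n (k * d)"
  using forms_prod[of "{..<k}" "\<lambda>_. p" n "\<lambda>_. d"] by simp

lemma subst_forms:
  assumes "p \<in> forms n d" "\<And>i. i \<in> {1..n} \<Longrightarrow> \<theta> i \<in> forms m 1"
  shows "subst \<theta> p \<in> forms m d"
  unfolding subst_def
proof (intro forms_sum forms_const_mult)
  fix t assume t: "t \<in> Poly_Mapping.keys p"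
  have "monomial_value \<theta> t \<in> forms m (\<Sum>i\<in>Poly_Mapping.keys t. Poly_Mapping.lookup t i * 1)"
    unfolding monomial_value_def
    by (intro forms_prod forms_power assms(2) polys_indexD[OF forms_subset[OF assms(1)] t])
  then show "monomial_value \<theta> t \<in> forms m d"
    using assms(1) t by (simp add: forms_def monom_degree_def)
qed

lemma subst_mem:
  assumes "p \<in> polys n" "\<And>i. i \<in> {1..n} \<Longrightarrow> \<theta> i \<in> polys m"
  shows "subst \<theta> p \<in> polys m"
  unfolding subst_def monomial_value_def
  by (intro poly.sum_mem poly.mult_mem const_poly_mem poly.prod_mem poly.power_mem assms(2) polys_indexD[OF assms(1)])

lemma subst_zero_forms:
  fixes p :: "'a::field mpoly"
  assumes "p \<in> forms n d" "d > 0"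
  shows "subst (\<lambda>_. 0) p = 0"
  unfolding subst_def
proof (intro sum.neutral ballI)
  fix t assume "t \<in> Poly_Mapping.keys p"
  then have "Poly_Mapping.keys t \<noteq> {}"
    using assms by (auto simp: forms_def monom_degree_def)
  then obtain i where i: "i \<in> Poly_Mapping.keys t" by blast
  have "monomial_value (\<lambda>_. 0 :: 'a mpoly) t = 0"
    unfolding monomial_value_def using i
    by (intro prod_zero) (auto simp: in_keys_iff)
  then show "const_poly (Poly_Mapping.lookup p t) * monomial_value (\<lambda>_. 0) t = 0" by simp
qed

lemma monomial_split:
  fixes t :: "nat \<Rightarrow>\<^sub>0 nat"
  assumes "k \<in> Poly_Mapping.keys t"
  obtains s where "t = s + Poly_Mapping.single k 1" "Poly_Mapping.keys s \<subseteq> Poly_Mapping.keys t"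
proof -
  define s where "s = t - Poly_Mapping.single k 1"
  have "t = s + Poly_Mapping.single k 1"
    using assms by (intro poly_mapping_eqI)
      (auto simp: s_def lookup_add lookup_minus lookup_single when_def in_keys_iff)
  moreover have "Poly_Mapping.keys s \<subseteq> Poly_Mapping.keys t"
    by (auto simp: s_def in_keys_iff lookup_minus)
  ultimately show ?thesis by (rule that)
qed

lemma forms_subset_ideal:
  assumes I: "poly.ideal_in n I" and var: "\<And>k. k \<in> {1..n} \<Longrightarrow> var k \<in> I"
    and p: "p \<in> forms n d" "d > 0"
  shows "p \<in> I"
proof -
  have "Poly_Mapping.single t (Poly_Mapping.lookup p t) \<in> I" if t: "t \<in> Poly_Mapping.keys p" for t
  proof -
    have "Poly_Mapping.keys t \<noteq> {}" "Poly_Mapping.keys t \<subseteq> {1..n}"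
      using p t by (auto simp: forms_def monom_degree_def polys_iff)
    then obtain k s where k: "k \<in> {1..n}" and s: "t = s + Poly_Mapping.single k 1"
      "Poly_Mapping.keys s \<subseteq> {1..n}"
      by (metis all_not_in_conv monomial_split subset_iff)
    have "Poly_Mapping.single s (Poly_Mapping.lookup p t) * var k \<in> I"
      using s(2) by (intro poly.ideal_in_mult[OF I] var k) (auto simp: polys_iff)
    then show ?thesis by (simp add: var_def mult_single s(1))
  qed
  then have "(\<Sum>t\<in>Poly_Mapping.keys p. Poly_Mapping.single t (Poly_Mapping.lookup p t)) \<in> I"
    by (intro poly.ideal_in_sum[OF I])
  then show ?thesis by (simp only: poly_as_sum_of_monomials[symmetric])
qed

abbreviation linear_coeff :: "'a::field mpoly \<Rightarrow> nat \<Rightarrow> 'a" where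
  "linear_coeff l i \<equiv> Poly_Mapping.lookup l (Poly_Mapping.single i 1)"

lemma linear_form_expand:
  assumes "l \<in> forms n 1"
  shows "l = (\<Sum>i\<in>{1..n}. const_poly (linear_coeff l i) * var i)"
proof (rule poly_mapping_eqI)
  fix t
  have *: "Poly_Mapping.lookup (\<Sum>i\<in>{1..n}. const_poly (linear_coeff l i) * var i) t =
      (\<Sum>i\<in>{1..n}. if Poly_Mapping.single i 1 = t then linear_coeff l i else 0)"
    by (auto simp: lookup_sum var_def lookup_single when_def intro!: sum.cong)
  show "Poly_Mapping.lookup l t =
      Poly_Mapping.lookup (\<Sum>i\<in>{1..n}. const_poly (linear_coeff l i) * var i) t"
  proof (cases "t \<in> Poly_Mapping.keys l")
    case True
    then have deg: "monom_degree t = 1" and vars: "Poly_Mapping.keys t \<subseteq> {1..n}"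
      using assms by (auto simp: forms_def polys_iff)
    then have "t \<noteq> 0" by (auto simp: monom_degree_def)
    then obtain k where k: "k \<in> Poly_Mapping.keys t" by (metis keys_eq_empty all_not_in_conv)
    then obtain s where s: "t = s + Poly_Mapping.single k 1" by (rule monomial_split)
    then have "monom_degree s = 0"
      using deg by (simp add: monom_degree_add) (simp add: monom_degree_def)
    then have "s = 0"
      by (simp add: monom_degree_def in_keys_iff poly_mapping_eqI) 
    then have t: "t = Poly_Mapping.single k 1" using s by simp
    have "(\<Sum>i\<in>{1..n}. if Poly_Mapping.single i 1 = t then linear_coeff l i else 0) =
        (\<Sum>i\<in>{1..n}. if i = k then linear_coeff l k else 0)"
      unfolding t by (intro sum.cong) (auto dest: arg_cong[where f=Poly_Mapping.keys])
    then show ?thesis using k vars unfolding * by (auto simp: t)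
  next
    case False
    then have "(\<Sum>i\<in>{1..n}. if Poly_Mapping.single i 1 = t then linear_coeff l i else 0) = 0"
      by (intro sum.neutral) (auto simp: in_keys_iff)
    then show ?thesis using False unfolding * by (simp add: in_keys_iff)
  qed
qed

lemma subst_linear_form:
  "l \<in> forms n 1 \<Longrightarrow> subst \<theta> l = (\<Sum>i\<in>{1..n}. const_poly (linear_coeff l i) * \<theta> i)"
  by (subst linear_form_expand) (simp_all add: subst_sum subst_mult)

text \<open>
  The value of a linear form at the point \<open>v\<close>; only the coefficients of degree \<open>1\<close> enter.
\<close>

definition lin_eval :: "nat \<Rightarrow> (nat \<Rightarrow> 'a) \<Rightarrow> 'a::field mpoly \<Rightarrow> 'a" where
  "lin_eval n v l = (\<Sum>i\<in>{1..n}. linear_coeff l i * v i)"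

lemma lin_eval_add: "lin_eval n v (p + q) = lin_eval n v p + lin_eval n v q"
  by (simp add: lin_eval_def lookup_add distrib_right sum.distrib)

lemma lin_eval_diff: "lin_eval n v (p - q) = lin_eval n v p - lin_eval n v q"
  by (simp add: lin_eval_def lookup_minus left_diff_distrib sum_subtractf)

lemma lin_eval_0 [simp]: "lin_eval n v 0 = 0"
  by (simp add: lin_eval_def)

lemma lin_eval_const_mult: "lin_eval n v (const_poly c * p) = c * lin_eval n v p"
  by (simp add: lin_eval_def sum_distrib_left mult.assoc)

lemma lin_eval_sum: "lin_eval n v (sum h A) = (\<Sum>x\<in>A. lin_eval n v (h x))"
  by (induction A rule: infinite_finite_induct) (auto simp: lin_eval_add)

lemma linear_coeff_var: "linear_coeff (var k) i = (if i = k then 1 else 0)"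
  by (auto simp: var_def lookup_single when_def dest: arg_cong[where f=Poly_Mapping.keys])

lemma lin_eval_var: "k \<in> {1..n} \<Longrightarrow> lin_eval n v (var k) = v k"
  unfolding lin_eval_def linear_coeff_var
  by (simp add: if_distrib[of "\<lambda>c. c * _"] cong: if_cong)

lemma lin_eval_subst:
  "l \<in> forms n 1 \<Longrightarrow> lin_eval m v (subst \<theta> l) = lin_eval n (\<lambda>i. lin_eval m v (\<theta> i)) l"
  by (simp add: subst_linear_form lin_eval_sum lin_eval_const_mult)
    (simp add: lin_eval_def)

section \<open>Linear independence of linear forms\<close>

text \<open>Index sets \<open>{1..n}\<close> and lists \<open>[1..<Suc n]\<close> are to keep their shape under simplification.\<close>

declare One_nat_def [simp del] upt_Suc [simp del]

lemma sum_atLeast1_atMost_shift: "(\<Sum>j\<in>{1..n}. g j) = (\<Sum>j\<in>{0..<n}. g (Suc j))"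
  by (induction n) simp_all

lemma det_eq_0_iff_kernel:
  fixes a :: "nat \<Rightarrow> nat \<Rightarrow> 'a::field"
  shows "det (mat n n (\<lambda>(i, j). a (Suc i) (Suc j))) = 0 \<longleftrightarrow>
    (\<exists>v. (\<exists>j\<in>{1..n}. v j \<noteq> 0) \<and> (\<forall>i\<in>{1..n}. (\<Sum>j\<in>{1..n}. a i j * v j) = 0))"
    (is "det ?A = 0 \<longleftrightarrow> ?R")
proof -
  have "det ?A = 0 \<longleftrightarrow> (\<exists>v. v \<in> carrier_vec n \<and> v \<noteq> 0\<^sub>v n \<and> ?A *\<^sub>v v = 0\<^sub>v n)"
    by (rule det_0_iff_vec_prod_zero_field) simp
  also have "\<dots> \<longleftrightarrow> ?R"
  proof
    assume "\<exists>v. v \<in> carrier_vec n \<and> v \<noteq> 0\<^sub>v n \<and> ?A *\<^sub>v v = 0\<^sub>v n"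
    then obtain v where v: "v \<in> carrier_vec n" "v \<noteq> 0\<^sub>v n" "?A *\<^sub>v v = 0\<^sub>v n" by blast
    obtain k where k: "k < n" "v $ k \<noteq> 0" using v(1,2) by (auto simp: vec_eq_iff)
    have "(\<Sum>j\<in>{1..n}. a i j * v $ (j - 1)) = 0" if i: "i \<in> {1..n}" for i
    proof -
      obtain i' where i': "i = Suc i'" "i' < n" using i by (cases i) auto
      then have "(?A *\<^sub>v v) $ i' = 0" using v(3) by simp
      then show ?thesis
        using i' v(1) unfolding sum_atLeast1_atMost_shift
        by (simp add: scalar_prod_def)
    qed
    then show ?R using k by (intro exI[of _ "\<lambda>j. v $ (j - 1)"]) (auto intro!: bexI[of _ "Suc k"])
  next
    assume ?R
    then obtain v k where k: "k \<in> {1..n}" "v k \<noteq> 0"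
      and v: "\<forall>i\<in>{1..n}. (\<Sum>j\<in>{1..n}. a i j * v j) = 0" by blast
    let ?v = "vec n (\<lambda>j. v (Suc j))"
    obtain k' where "k = Suc k'" "k' < n" using k(1) by (cases k) auto
    then have "?v $ k' \<noteq> 0\<^sub>v n $ k'" using k(2) by simp
    then have "?v \<noteq> 0\<^sub>v n" by metis
    moreover have "?A *\<^sub>v ?v = 0\<^sub>v n"
    proof (rule eq_vecI)
      fix i assume "i < dim_vec (0\<^sub>v n :: 'a vec)"
      then show "(?A *\<^sub>v ?v) $ i = 0\<^sub>v n $ i"
        using v[rule_format, of "Suc i"] unfolding sum_atLeast1_atMost_shift
        by (simp add: scalar_prod_def)
    qed simp
    ultimately show "\<exists>v. v \<in> carrier_vec n \<and> v \<noteq> 0\<^sub>v n \<and> ?A *\<^sub>v v = 0\<^sub>v n"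
      by (intro exI[of _ ?v]) simp
  qed
  finally show ?thesis .
qed

lemma nontrivial_kernel_imp_row_relation:
  fixes a :: "nat \<Rightarrow> nat \<Rightarrow> 'a::field"
  assumes "k \<in> {1..n}" "v k \<noteq> 0" "\<And>i. i \<in> {1..n} \<Longrightarrow> (\<Sum>j\<in>{1..n}. a i j * v j) = 0"
  obtains w k where "k \<in> {1..n}" "w k \<noteq> 0" "\<And>j. j \<in> {1..n} \<Longrightarrow> (\<Sum>i\<in>{1..n}. w i * a i j) = 0"
proof -
  let ?A = "\<lambda>a. mat n n (\<lambda>(i, j). a (Suc i) (Suc j)) :: 'a mat"
  have "det (?A a) = 0" using assms by (subst det_eq_0_iff_kernel) blast
  moreover have "transpose_mat (?A a) = ?A (\<lambda>i j. a j i)" by auto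
  ultimately have "det (?A (\<lambda>i j. a j i)) = 0"
    using det_transpose[of "?A a" n] by simp
  then obtain w k where "k \<in> {1..n}" "w k \<noteq> 0"
    and "\<forall>i\<in>{1..n}. (\<Sum>j\<in>{1..n}. a j i * w j) = 0"
    unfolding det_eq_0_iff_kernel[of n "\<lambda>i j. a j i"] by blast
  then show ?thesis using that[of k w] by (simp add: mult.commute)
qed

lemma trivial_kernel_imp_inverse:
  fixes a :: "nat \<Rightarrow> nat \<Rightarrow> 'a::field"
  assumes "\<And>v. (\<forall>i\<in>{1..n}. (\<Sum>j\<in>{1..n}. a i j * v j) = 0) \<Longrightarrow> \<forall>j\<in>{1..n}. v j = 0"
  obtains b where
    "\<And>i k. i \<in> {1..n} \<Longrightarrow> k \<in> {1..n} \<Longrightarrow> (\<Sum>j\<in>{1..n}. a i j * b j k) = (if i = k then 1 else 0)"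
    "\<And>i k. i \<in> {1..n} \<Longrightarrow> k \<in> {1..n} \<Longrightarrow> (\<Sum>j\<in>{1..n}. b i j * a j k) = (if i = k then 1 else 0)"
proof -
  let ?A = "mat n n (\<lambda>(i, j). a (Suc i) (Suc j))"
  have A: "?A \<in> carrier_mat n n" by simp
  have "det ?A \<noteq> 0" using assms unfolding det_eq_0_iff_kernel by blast
  then have "?A \<in> Units (ring_mat TYPE('a) n ())" by (intro det_non_zero_imp_unit[OF A])
  then obtain B where B: "B \<in> carrier_mat n n" "?A * B = 1\<^sub>m n" "B * ?A = 1\<^sub>m n"
    unfolding Units_def ring_mat_def by auto
  let ?b = "\<lambda>i j. B $$ (i - 1, j - 1)"
  show ?thesis
  proof (rule that[of ?b])
    fix i k assume "i \<in> {1..n}" "k \<in> {1..n}"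
    then obtain i' k' where ik: "i = Suc i'" "i' < n" "k = Suc k'" "k' < n"
      by (cases i; cases k) auto
    have "(?A * B) $$ (i', k') = (if i = k then 1 else 0)"
      using ik by (subst B) auto
    then show "(\<Sum>j\<in>{1..n}. a i j * ?b j k) = (if i = k then 1 else 0)"
      using ik B(1) unfolding sum_atLeast1_atMost_shift by (simp add: scalar_prod_def)
    have "(B * ?A) $$ (i', k') = (if i = k then 1 else 0)"
      using ik by (subst B) auto
    then show "(\<Sum>j\<in>{1..n}. ?b i j * a j k) = (if i = k then 1 else 0)"
      using ik B(1) unfolding sum_atLeast1_atMost_shift by (simp add: scalar_prod_def)
  qed
qed

lemma ideal_subst_kernel:
  "poly.ideal_in n {p \<in> polys n. subst \<theta> p = 0}"
  by (auto simp: poly.ideal_in_def subst_add subst_mult)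

lemma subst_zero_adjoin_list:
  assumes "p \<in> poly.adjoin_list n {0} fs" "\<And>f. f \<in> set fs \<Longrightarrow> f \<in> polys n \<and> subst \<theta> f = 0"
  shows "subst \<theta> p = 0"
  using poly.adjoin_list_least[OF ideal_subst_kernel, of "{0}" n \<theta> fs] assms by auto

lemma linear_combination_expand:
  assumes "\<And>i. i \<in> {1..n} \<Longrightarrow> l i \<in> forms n 1"
  shows "(\<Sum>i\<in>{1..n}. const_poly (w i) * l i) =
    (\<Sum>j\<in>{1..n}. const_poly (\<Sum>i\<in>{1..n}. w i * linear_coeff (l i) j) * var j)"
proof -
  have "const_poly (w i) * l i =
      (\<Sum>j\<in>{1..n}. const_poly (w i * linear_coeff (l i) j) * var j)" if "i \<in> {1..n}" for i
    by (subst linear_form_expand[OF assms[OF that]])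
      (simp add: sum_distrib_left const_poly_mult[symmetric] mult.assoc)
  then have "(\<Sum>i\<in>{1..n}. const_poly (w i) * l i) =
      (\<Sum>i\<in>{1..n}. \<Sum>j\<in>{1..n}. const_poly (w i * linear_coeff (l i) j) * var j)"
    by (rule sum.cong[OF refl])
  also have "\<dots> = (\<Sum>j\<in>{1..n}. const_poly (\<Sum>i\<in>{1..n}. w i * linear_coeff (l i) j) * var j)"
    by (subst sum.swap) (simp add: const_poly_sum sum_distrib_right)
  finally show ?thesis .
qed

text \<open>
  If \<open>n\<close> linear forms vanish simultaneously only at the origin, then they are a basis of the linear
  forms: \<open>b\<close> expresses the variables in this basis, so the \<open>l i\<close> can be sent to arbitrary
  polynomials \<open>c i\<close> by a substitution.
\<close>

lemma inverse_coefficients: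
  fixes l :: "nat \<Rightarrow> 'a::field mpoly"
  assumes l: "\<And>i. i \<in> {1..n} \<Longrightarrow> l i \<in> forms n 1"
    and zero: "\<And>v. \<forall>i\<in>{1..n}. lin_eval n v (l i) = 0 \<Longrightarrow> \<forall>i\<in>{1..n}. v i = 0"
  obtains b where
    "\<And>j. j \<in> {1..n} \<Longrightarrow> var j = (\<Sum>i\<in>{1..n}. const_poly (b j i) * l i)"
    "\<And>i c. i \<in> {1..n} \<Longrightarrow>
      subst (\<lambda>j. \<Sum>k\<in>{1..n}. const_poly (b j k) * c k) (l i) = c i"
proof -
  obtain b where b:
    "\<And>i k. i \<in> {1..n} \<Longrightarrow> k \<in> {1..n} \<Longrightarrow>
      (\<Sum>j\<in>{1..n}. linear_coeff (l i) j * b j k) = (if i = k then 1 else 0)"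
    "\<And>i k. i \<in> {1..n} \<Longrightarrow> k \<in> {1..n} \<Longrightarrow>
      (\<Sum>j\<in>{1..n}. b i j * linear_coeff (l j) k) = (if i = k then 1 else 0)"
    by (rule trivial_kernel_imp_inverse[of n "\<lambda>i. linear_coeff (l i)",
          OF zero[unfolded lin_eval_def]]) blast+
  show ?thesis
  proof (rule that[of b])
    fix j assume j: "j \<in> {1..n}"
    have "(\<Sum>i\<in>{1..n}. const_poly (b j i) * l i) =
        (\<Sum>k\<in>{1..n}. const_poly (\<Sum>i\<in>{1..n}. b j i * linear_coeff (l i) k) * var k)"
      by (rule linear_combination_expand[OF l])
    also have "\<dots> = (\<Sum>k\<in>{1..n}. if j = k then var k else 0)"
      using j by (intro sum.cong) (auto simp: b(2))
    finally show "var j = (\<Sum>i\<in>{1..n}. const_poly (b j i) * l i)" using j by simp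
  next
    fix i and c :: "nat \<Rightarrow> 'a mpoly"
    assume i: "i \<in> {1..n}"
    have "subst (\<lambda>j. \<Sum>k\<in>{1..n}. const_poly (b j k) * c k) (l i) =
        (\<Sum>j\<in>{1..n}. \<Sum>k\<in>{1..n}. const_poly (linear_coeff (l i) j * b j k) * c k)"
      unfolding subst_linear_form[OF l[OF i]]
      by (simp add: sum_distrib_left const_poly_mult[symmetric] mult.assoc)
    also have "\<dots> = (\<Sum>k\<in>{1..n}. const_poly (\<Sum>j\<in>{1..n}. linear_coeff (l i) j * b j k) * c k)"
      by (subst sum.swap) (simp add: const_poly_sum sum_distrib_right)
    also have "\<dots> = (\<Sum>k\<in>{1..n}. if i = k then c k else 0)"
      using i by (intro sum.cong) (auto simp: b(1))
    finally show "subst (\<lambda>j. \<Sum>k\<in>{1..n}. const_poly (b j k) * c k) (l i) = c i"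
      using i by simp
  qed
qed

text \<open>
  A common zero other than the origin makes the matrix of coefficients singular, so there is a
  linear relation between the \<open>l i\<close>. Then some \<open>l m\<close> is a combination of its predecessors, that is,
  zero modulo them, and cannot be a nonzerodivisor because the predecessors do not generate \<open>1\<close>.
\<close>

lemma regular_list_linear_forms_imp:
  fixes l :: "nat \<Rightarrow> 'a::field mpoly"
  assumes l: "\<And>i. i \<in> {1..n} \<Longrightarrow> l i \<in> forms n 1"
    and reg: "poly.regular_list n {0} (map l [1..<Suc n])"
    and v: "\<forall>i\<in>{1..n}. lin_eval n v (l i) = 0" and k: "k \<in> {1..n}"
  shows "v k = 0"
proof (rule ccontr)
  assume "v k \<noteq> 0"
  then obtain w k where "k \<in> {1..n}" "w k \<noteq> 0"
    and w: "\<And>j. j \<in> {1..n} \<Longrightarrow> (\<Sum>i\<in>{1..n}. w i * linear_coeff (l i) j) = 0"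
    by (rule nontrivial_kernel_imp_row_relation[OF k, of v "\<lambda>i. linear_coeff (l i)"])
      (use v in \<open>auto simp: lin_eval_def\<close>)
  \<comment> \<open>The last form in the relation depends linearly on its predecessors.\<close>
  define m where "m = Max {i \<in> {1..n}. w i \<noteq> 0}"
  have "m \<in> {i \<in> {1..n}. w i \<noteq> 0}"
    unfolding m_def using \<open>k \<in> {1..n}\<close> \<open>w k \<noteq> 0\<close> by (intro Max_in) auto
  then have m: "m \<in> {1..n}" "w m \<noteq> 0" by auto
  have above: "w i = 0" if "i \<in> {1..n}" "i > m" for i
  proof (rule ccontr)
    assume "w i \<noteq> 0"
    then have "i \<le> m" unfolding m_def using that by (intro Max_ge) auto
    then show False using that by simp
  qed
  let ?J = "poly.adjoin_list n {0} (map l [1..<m])"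
  have J: "poly.ideal_in n ?J"
    using m l forms_subset by (intro poly.ideal_in_adjoin_list poly.ideal_in_zero) fastforce
  have "(\<Sum>i\<in>{1..n}. const_poly (w i) * l i) =
      (\<Sum>j\<in>{1..n}. const_poly (\<Sum>i\<in>{1..n}. w i * linear_coeff (l i) j) * var j)"
    by (rule linear_combination_expand[OF l])
  also have "\<dots> = 0" by (intro sum.neutral ballI) (simp add: w del: One_nat_def)
  finally have "(\<Sum>i\<in>{1..n}. const_poly (w i) * l i) = 0" .
  moreover have "(\<Sum>i\<in>{1..n}. const_poly (w i) * l i) =
      (\<Sum>i\<in>insert m {1..<m}. const_poly (w i) * l i)"
    using m above by (intro sum.mono_neutral_right) auto
  ultimately have "const_poly (w m) * l m = - (\<Sum>i\<in>{1..<m}. const_poly (w i) * l i)"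
    by (simp add: eq_neg_iff_add_eq_0)
  moreover have "(\<Sum>i\<in>{1..<m}. const_poly (w i) * l i) \<in> ?J"
    using poly.set_subset_adjoin_list[of "{0}" "map l [1..<m]" n]
    by (intro poly.ideal_in_sum[OF J] poly.ideal_in_mult[OF J]) auto
  ultimately have "const_poly (w m) * l m \<in> ?J"
    using poly.ideal_in_uminus[OF J] by simp
  moreover have "poly.nonzerodivisor_mod n ?J (l m)"
    using reg m(1) unfolding poly.regular_list_map_upt by blast
  ultimately have "const_poly (w m) \<in> ?J" by (simp add: poly.nonzerodivisor_mod_def)
  then have "subst (\<lambda>_. 0) (const_poly (w m)) = 0"
    by (rule subst_zero_adjoin_list)
      (use m l in \<open>auto intro!: forms_subset[of _ n 1] subst_zero_forms[of _ n 1]\<close>)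
  then have "Poly_Mapping.lookup (const_poly (w m)) 0 = 0" by simp
  then show False using m by simp
qed

text \<open>
  The \<open>l i\<close> are a basis of the linear forms, so the polynomial ring can be projected along
  \<open>l 1, \<dots>, l (k - 1)\<close>. This identifies the quotient by these forms with a subring of an integral
  domain, and \<open>l k\<close> with a nonzero element.
\<close>

lemma regular_list_linear_formsI:
  fixes l :: "nat \<Rightarrow> 'a::field mpoly"
  assumes l: "\<And>i. i \<in> {1..n} \<Longrightarrow> l i \<in> forms n 1"
    and zero: "\<And>v. \<forall>i\<in>{1..n}. lin_eval n v (l i) = 0 \<Longrightarrow> \<forall>i\<in>{1..n}. v i = 0"
  shows "poly.regular_list n {0} (map l [1..<Suc n])"
  unfolding poly.regular_list_map_upt
proof
  fix k assume k: "k \<in> {1..n}"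
  obtain b where b:
    "\<And>j. j \<in> {1..n} \<Longrightarrow> var j = (\<Sum>i\<in>{1..n}. const_poly (b j i) * l i)"
    "\<And>i c. i \<in> {1..n} \<Longrightarrow> subst (\<lambda>j. \<Sum>k\<in>{1..n}. const_poly (b j k) * c k) (l i) = c i"
    by (rule inverse_coefficients[of n l, OF l zero]) blast+
  let ?J = "poly.adjoin_list n {0} (map l [1..<k])"
  have J: "poly.ideal_in n ?J"
    using k l forms_subset by (intro poly.ideal_in_adjoin_list poly.ideal_in_zero) fastforce
  have l_in_J: "l i \<in> ?J" if "i \<in> {1..<k}" for i
    using poly.set_subset_adjoin_list[of "{0}" "map l [1..<k]" n] that
    by (auto simp del: poly.adjoin_list_simps)
  \<comment> \<open>\<open>subst \<theta>\<close> kills the first \<open>k - 1\<close> forms and fixes the others.\<close>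
  define \<theta> where "\<theta> = (\<lambda>j. \<Sum>i\<in>{1..n}. const_poly (b j i) * (if i < k then 0 else l i))"
  have \<theta>_l: "subst \<theta> (l i) = (if i < k then 0 else l i)" if "i \<in> {1..n}" for i
    using b(2)[OF that] unfolding \<theta>_def .
  have \<theta>_mem: "\<theta> j \<in> polys n" for j
    unfolding \<theta>_def using forms_subset l by (intro poly.sum_mem poly.mult_mem) auto
  have cong: "p - subst \<theta> p \<in> ?J" if "p \<in> polys n" for p
    using that
  proof (induction p rule: polys_induct)
    case (const c)
    then show ?case using poly.ideal_in_0[OF J] by simp
  next
    case (var j)
    have "var j - \<theta> j = (\<Sum>i\<in>{1..n}. const_poly (b j i) * (l i - (if i < k then 0 else l i)))"
      unfolding b(1)[OF var] \<theta>_def by (simp add: sum_subtractf right_diff_distrib)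
    also have "\<dots> \<in> ?J"
      using poly.ideal_in_0[OF J] l_in_J
      by (intro poly.ideal_in_sum[OF J] poly.ideal_in_mult[OF J]) auto
    finally show ?case by simp
  next
    case (add p q)
    then have "(p - subst \<theta> p) + (q - subst \<theta> q) \<in> ?J" by (intro poly.ideal_in_add[OF J])
    then show ?case by (simp add: subst_add algebra_simps)
  next
    case (mult p q)
    have "subst \<theta> p \<in> polys n" using mult \<theta>_mem by (intro subst_mem)
    then have "q * (p - subst \<theta> p) + subst \<theta> p * (q - subst \<theta> q) \<in> ?J"
      using mult by (intro poly.ideal_in_add[OF J] poly.ideal_in_mult[OF J])
    then show ?case by (simp add: subst_mult algebra_simps)
  qed
  have \<theta>_J: "subst \<theta> p = 0" if "p \<in> ?J" for p
    using that by (rule subst_zero_adjoin_list) (use k l forms_subset \<theta>_l in fastforce)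
  \<comment> \<open>A basis element can be mapped to anything, here to \<open>1\<close>, so it is nonzero.\<close>
  have "subst (\<lambda>j. \<Sum>i\<in>{1..n}. const_poly (b j i) * 1) (l k) = 1"
    by (rule b(2)[OF k])
  then have "l k \<noteq> 0" by auto
  show "poly.nonzerodivisor_mod n ?J (l k)"
    unfolding poly.nonzerodivisor_mod_def
  proof (intro ballI impI)
    fix h assume h: "h \<in> polys n" "h * l k \<in> ?J"
    have "subst \<theta> h * l k = 0"
      using \<theta>_J[OF h(2)] \<theta>_l[OF k] by (simp add: subst_mult)
    then have "subst \<theta> h = 0" using \<open>l k \<noteq> 0\<close> by simp
    then show "h \<in> ?J" using cong[OF h(1)] by simp
  qed
qed

section \<open>Quotients of polynomial rings and regular sequences\<close>

lemma ideal_iff_ideal_in: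
  fixes I :: "'a::field mpoly set"
  shows "ideal I (mpoly_ring n) \<longleftrightarrow> poly.ideal_in n I"
proof
  assume "ideal I (mpoly_ring n)"
  then interpret ideal I "mpoly_ring n" .
  show "poly.ideal_in n I"
    unfolding poly.ideal_in_def 
    using a_subset additive_subgroup.zero_closed[OF is_additive_subgroup]
      additive_subgroup.a_closed[OF is_additive_subgroup] I_l_closed by simp
next
  assume I: "poly.ideal_in n I"
  interpret R: cring "mpoly_ring n :: 'a mpoly ring" by (rule cring_mpoly_ring)
  show "ideal I (mpoly_ring n)"
  proof (intro idealI R.ring_axioms)
    have inv: "\<ominus>\<^bsub>mpoly_ring n\<^esub> p = - p" if "p \<in> polys n" for p :: "'a mpoly"
      using that by (intro R.minus_equality) auto
    show "subgroup I (add_monoid (mpoly_ring n))"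
    proof
      show "inv\<^bsub>add_monoid (mpoly_ring n)\<^esub> p \<in> I" if "p \<in> I" for p
        using inv[of p] that poly.ideal_in_subset[OF I] poly.ideal_in_uminus[OF I]
        by (simp add: a_inv_def)
    qed (use I in \<open>auto simp: poly.ideal_in_def\<close>)
  qed (use poly.ideal_in_mult[OF I] poly.ideal_in_mult_right[OF I] in auto)
qed

lemma Idl_eq_adjoin_list:
  assumes "set fs \<subseteq> polys n"
  shows "Idl\<^bsub>mpoly_ring n\<^esub> (set fs) = poly.adjoin_list n {0} (fs :: 'a::field mpoly list)"
proof
  interpret R: cring "mpoly_ring n :: 'a mpoly ring" by (rule cring_mpoly_ring)
  show "Idl\<^bsub>mpoly_ring n\<^esub> (set fs) \<subseteq> poly.adjoin_list n {0} fs"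
    using assms poly.set_subset_adjoin_list[of "{0}" fs n]
    by (intro R.genideal_minimal)
      (auto simp: ideal_iff_ideal_in poly.ideal_in_adjoin_list poly.ideal_in_zero)
  have "poly.ideal_in n (Idl\<^bsub>mpoly_ring n\<^esub> (set fs))"
    using R.genideal_ideal[OF assms] by (simp add: ideal_iff_ideal_in)
  then show "poly.adjoin_list n {0} fs \<subseteq> Idl\<^bsub>mpoly_ring n\<^esub> (set fs)"
    using R.genideal_self[OF assms] poly.ideal_in_0
    by (intro poly.adjoin_list_least) auto
qed

lemma seq_ideal_eq:
  assumes "\<And>i. i \<in> {1..n} \<Longrightarrow> f i \<in> polys n"
  shows "seq_ideal n f = poly.adjoin_list n {0} (map f [1..<Suc n])"
proof -
  have "f ` {1..n} = set (map f [1..<Suc n])" by auto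
  then show ?thesis
    unfolding seq_ideal_def using assms Idl_eq_adjoin_list[of "map f [1..<Suc n]" n] by fastforce
qed

context
  fixes n :: nat and I :: "'a::field mpoly set"
  assumes I: "poly.ideal_in n I"
begin

interpretation R: cring "mpoly_ring n :: 'a mpoly ring" by (rule cring_mpoly_ring)
interpretation ideal I "mpoly_ring n" using I by (simp add: ideal_iff_ideal_in)

lemma quotient_carrier: "carrier (mpoly_ring n Quot I) = (\<lambda>p. I +>\<^bsub>mpoly_ring n\<^esub> p) ` polys n"
  by (auto simp: FactRing_def A_RCOSETS_def')

lemma quotient_mult:
  "p \<in> polys n \<Longrightarrow> q \<in> polys n \<Longrightarrow>
    (I +>\<^bsub>mpoly_ring n\<^esub> p) \<otimes>\<^bsub>mpoly_ring n Quot I\<^esub> (I +>\<^bsub>mpoly_ring n\<^esub> q) =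
    I +>\<^bsub>mpoly_ring n\<^esub> (p * q)"
  using ring_hom_mult[OF rcos_ring_hom] by simp

lemma quotient_add:
  "p \<in> polys n \<Longrightarrow> q \<in> polys n \<Longrightarrow>
    (I +>\<^bsub>mpoly_ring n\<^esub> p) \<oplus>\<^bsub>mpoly_ring n Quot I\<^esub> (I +>\<^bsub>mpoly_ring n\<^esub> q) =
    I +>\<^bsub>mpoly_ring n\<^esub> (p + q)"
  using ring_hom_add[OF rcos_ring_hom] by simp

lemma quotient_one: "\<one>\<^bsub>mpoly_ring n Quot I\<^esub> = I +>\<^bsub>mpoly_ring n\<^esub> 1"
  using ring_hom_one[OF rcos_ring_hom] by simp

lemma quotient_zero: "\<zero>\<^bsub>mpoly_ring n Quot I\<^esub> = I"
  by (simp add: FactRing_def)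

lemma coset_altdef: "I +>\<^bsub>mpoly_ring n\<^esub> p = (\<lambda>i. i + p) ` I"
  by (auto simp: a_r_coset_def')

lemma coset_eq_iff:
  "I +>\<^bsub>mpoly_ring n\<^esub> p = I +>\<^bsub>mpoly_ring n\<^esub> q \<longleftrightarrow> p - q \<in> I"
proof
  assume "I +>\<^bsub>mpoly_ring n\<^esub> p = I +>\<^bsub>mpoly_ring n\<^esub> q"
  moreover have "p \<in> I +>\<^bsub>mpoly_ring n\<^esub> p"
    using poly.ideal_in_0[OF I] by (force simp: coset_altdef)
  ultimately show "p - q \<in> I" by (auto simp: coset_altdef)
next
  assume pq: "p - q \<in> I"
  have "i + p \<in> I +>\<^bsub>mpoly_ring n\<^esub> q" if "i \<in> I" for i
    using poly.ideal_in_add[OF I that pq] by (force simp: coset_altdef)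
  moreover have "i + q \<in> I +>\<^bsub>mpoly_ring n\<^esub> p" if "i \<in> I" for i
    using poly.ideal_in_diff[OF I that pq] by (force simp: coset_altdef)
  ultimately show "I +>\<^bsub>mpoly_ring n\<^esub> p = I +>\<^bsub>mpoly_ring n\<^esub> q"
    by (auto simp: coset_altdef)
qed

lemma coset_eq_ideal_iff: "I +>\<^bsub>mpoly_ring n\<^esub> p = I \<longleftrightarrow> p \<in> I"
  using coset_eq_iff[of p 0] by (simp add: coset_altdef)

lemma zero_divisor_quotient_iff:
  assumes "a \<in> polys n"
  shows "zero_divisor (mpoly_ring n Quot I) (I +>\<^bsub>mpoly_ring n\<^esub> a) \<longleftrightarrow>
    \<not> poly.nonzerodivisor_mod n I a"
  using assms
  by (auto simp: zero_divisor_def poly.nonzerodivisor_mod_def quotient_carrier quotient_mult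
      quotient_zero coset_eq_ideal_iff mult.commute)

text \<open>
  The annihilator of the class of \<open>s\<close> is an ideal, so it contains all forms of positive degree as
  soon as it contains the variables.
\<close>

lemma coset_in_socle:
  assumes s: "s \<in> polys n" and var: "\<And>k. k \<in> {1..n} \<Longrightarrow> s * var k \<in> I"
  shows "I +>\<^bsub>mpoly_ring n\<^esub> s \<in> socle n I"
proof -
  let ?Q = "mpoly_ring n Quot I"
  let ?ann = "{a \<in> polys n. s * a \<in> I}"
  interpret Q: ring ?Q by (rule quotient_is_ring)
  have ann: "poly.ideal_in n ?ann"
    unfolding poly.ideal_in_def
  proof (intro conjI ballI)
    fix r a :: "'a mpoly" assume "r \<in> polys n" "a \<in> ?ann"
    then show "r * a \<in> ?ann"
      using poly.ideal_in_mult[OF I, of r "s * a"] by (auto simp: ac_simps)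
  qed (use poly.ideal_in_0[OF I] poly.ideal_in_add[OF I] in \<open>auto simp: distrib_left\<close>)
  have "ideal ((+>\<^bsub>mpoly_ring n\<^esub>) I ` ?ann) ?Q"
    using ann ideal_axioms by (intro R.ring_ideal_imp_quot_ideal) (simp_all add: ideal_iff_ideal_in)
  moreover have "graded_part n I d \<subseteq> (+>\<^bsub>mpoly_ring n\<^esub>) I ` ?ann" if "d \<ge> 1" for d
    unfolding graded_part_def
  proof (intro image_mono subsetI)
    have "var k \<in> ?ann" if "k \<in> {1..n}" for k using that var var_mem by blast
    then show "p \<in> ?ann" if "p \<in> forms n d" for p
      using that \<open>d \<ge> 1\<close> by (intro forms_subset_ideal[OF ann, of p d]) auto
  qed
  ultimately have "positive_ideal n I \<subseteq> (+>\<^bsub>mpoly_ring n\<^esub>) I ` ?ann"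
    unfolding positive_ideal_def by (intro Q.genideal_minimal) auto
  moreover have "(I +>\<^bsub>mpoly_ring n\<^esub> s) \<otimes>\<^bsub>?Q\<^esub> a = \<zero>\<^bsub>?Q\<^esub>"
    if a: "a \<in> (+>\<^bsub>mpoly_ring n\<^esub>) I ` ?ann" for a
  proof -
    obtain b where "a = I +>\<^bsub>mpoly_ring n\<^esub> b" "b \<in> polys n" "s * b \<in> I"
      using a by blast
    then show ?thesis using s by (simp add: quotient_mult quotient_zero coset_eq_ideal_iff)
  qed
  ultimately show ?thesis
    using s unfolding socle_def quotient_carrier by blast
qed

end

lemma regular_sequence_iff_regular_list:
  fixes f :: "nat \<Rightarrow> 'a::field mpoly"
  shows "regular_sequence n f \<longleftrightarrow>
    (\<forall>i\<in>{1..n}. \<exists>d>0. f i \<in> forms n d) \<and> poly.regular_list n {0} (map f [1..<Suc n])"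
proof (cases "\<forall>i\<in>{1..n}. \<exists>d>0. f i \<in> forms n d")
  case True
  then have mem: "f i \<in> polys n" if "i \<in> {1..n}" for i
    using that forms_subset by blast
  let ?J = "\<lambda>k. poly.adjoin_list n {0} (map f [1..<k])"
  have nzd: "poly.nonzerodivisor_mod n (?J k) (f k) \<longleftrightarrow>
      (let J = Idl\<^bsub>mpoly_ring n\<^esub> (f ` {1..k - 1}) in
        \<not> zero_divisor (mpoly_ring n Quot J) (J +>\<^bsub>mpoly_ring n\<^esub> f k))" if "k \<in> {2..n}" for k
  proof -
    have "set (map f [1..<k]) \<subseteq> polys n" using that mem by auto
    moreover have "f ` {1..k - 1} = set (map f [1..<k])" using that by auto
    ultimately show ?thesis
      using that mem Idl_eq_adjoin_list[of "map f [1..<k]" n]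
      by (simp add: zero_divisor_quotient_iff poly.ideal_in_adjoin_list poly.ideal_in_zero)
  qed
  have one: "poly.nonzerodivisor_mod n (?J 1) (f 1) \<longleftrightarrow> f 1 \<noteq> 0"
    by (auto simp: poly.nonzerodivisor_mod_def dest: bspec[of _ _ 1])
  have "poly.regular_list n {0} (map f [1..<Suc n]) \<longleftrightarrow>
      (\<forall>k\<in>{1..n}. poly.nonzerodivisor_mod n (?J k) (f k))"
    by (rule poly.regular_list_map_upt)
  also have "\<dots> \<longleftrightarrow> (1 \<le> n \<longrightarrow> poly.nonzerodivisor_mod n (?J 1) (f 1)) \<and>
      (\<forall>k\<in>{2..n}. poly.nonzerodivisor_mod n (?J k) (f k))"
  proof (cases "1 \<le> n")
    case True
    then have "{1..n} = insert 1 {2..n}" by auto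
    then show ?thesis using True by simp
  qed simp
  also have "\<dots> \<longleftrightarrow> (1 \<le> n \<longrightarrow> f 1 \<noteq> 0) \<and> (\<forall>k\<in>{2..n}. let J = Idl\<^bsub>mpoly_ring n\<^esub> (f ` {1..k - 1}) in
        \<not> zero_divisor (mpoly_ring n Quot J) (J +>\<^bsub>mpoly_ring n\<^esub> f k))"
    by (intro conj_cong imp_cong ball_cong refl one nzd)
  finally show ?thesis
    unfolding regular_sequence_def using True by blast
next
  case False
  then show ?thesis unfolding regular_sequence_def by blast
qed

lemma regular_sequence_cong:
  assumes "\<And>i. i \<in> {1..n} \<Longrightarrow> f i = g i"
  shows "regular_sequence n f = regular_sequence n g"
proof -
  have "map f [1..<Suc n] = map g [1..<Suc n]" using assms by (intro map_cong) auto
  moreover have "(\<forall>i\<in>{1..n}. \<exists>d>0. f i \<in> forms n d) = (\<forall>i\<in>{1..n}. \<exists>d>0. g i \<in> forms n d)"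
    using assms by simp
  ultimately show ?thesis unfolding regular_sequence_iff_regular_list by (simp only:)
qed

lemma seq_ideal_cong: "(\<And>i. i \<in> {1..n} \<Longrightarrow> f i = g i) \<Longrightarrow> seq_ideal n f = seq_ideal n g"
  unfolding seq_ideal_def by (metis image_cong)

lemma prod_list_map_upt: "prod_list (map g [1..<Suc k]) = (\<Prod>j=1..k. g j :: 'b::comm_monoid_mult)"
  by (induction k) (simp_all add: upt_Suc)

text \<open>
  Multiplicativity reduces regularity to all choices \<open>t\<close> of one factor per product, and \<open>n\<close> linear
  forms are regular iff they have no common zero but the origin. A point is a common zero of
  the products iff it is a common zero of some choice of factors.
\<close>

theorem regular_sequence_prod_linear_iff:
  fixes p :: "nat \<Rightarrow> nat \<Rightarrow> 'a::field mpoly"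
  assumes N: "\<And>i. i \<in> {1..n} \<Longrightarrow> N i \<ge> 1"
    and p: "\<And>i j. i \<in> {1..n} \<Longrightarrow> j \<in> {1..N i} \<Longrightarrow> p i j \<in> forms n 1"
  shows "regular_sequence n (\<lambda>i. \<Prod>j=1..N i. p i j) \<longleftrightarrow>
    (\<forall>v. (\<forall>i\<in>{1..n}. \<exists>j\<in>{1..N i}. lin_eval n v (p i j) = 0) \<longrightarrow> (\<forall>i\<in>{1..n}. v i = 0))"
proof -
  have "\<exists>d>0. (\<Prod>j=1..N i. p i j) \<in> forms n d" if "i \<in> {1..n}" for i
  proof -
    have "(\<Prod>j=1..N i. p i j) \<in> forms n (\<Sum>j=1..N i. 1)"
      using that p by (intro forms_prod) auto
    then show ?thesis using N[OF that] by (intro exI[of _ "N i"]) auto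
  qed
  moreover define Us where "Us = map (\<lambda>i. map (p i) [1..<Suc (N i)]) [1..<Suc n]"
  have "map (\<lambda>i. \<Prod>j=1..N i. p i j) [1..<Suc n] = map prod_list Us"
    by (simp add: Us_def prod_list_map_upt)
  moreover have "poly.regular_list n {0} (map prod_list Us) \<longleftrightarrow>
      (\<forall>t. list_all2 (\<lambda>u us. u \<in> set us) t Us \<longrightarrow> poly.regular_list n {0} t)"
  proof (rule poly.regular_list_map_prod_list)
    show "\<Union>(set ` set Us) \<subseteq> polys n"
      using p forms_subset[of _ n 1] by (force simp: Us_def)
    show "[] \<notin> set Us" using N by (force simp: Us_def)
  qed (rule poly.ideal_in_zero)
  moreover have "(\<forall>t. list_all2 (\<lambda>u us. u \<in> set us) t Us \<longrightarrow> poly.regular_list n {0} t) \<longleftrightarrow>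
    (\<forall>v. (\<forall>i\<in>{1..n}. \<exists>j\<in>{1..N i}. lin_eval n v (p i j) = 0) \<longrightarrow> (\<forall>i\<in>{1..n}. v i = 0))"
  proof (intro iffI allI impI)
    fix v assume reg: "\<forall>t. list_all2 (\<lambda>u us. u \<in> set us) t Us \<longrightarrow> poly.regular_list n {0} t"
      and "\<forall>i\<in>{1..n}. \<exists>j\<in>{1..N i}. lin_eval n v (p i j) = 0"
    then have "\<forall>i\<in>{1..n}. \<exists>j. j \<in> {1..N i} \<and> lin_eval n v (p i j) = 0" by blast
    then obtain c where c: "\<And>i. i \<in> {1..n} \<Longrightarrow> c i \<in> {1..N i} \<and> lin_eval n v (p i (c i)) = 0"
      unfolding bchoice_iff by blast
    have "list_all2 (\<lambda>u us. u \<in> set us) (map (\<lambda>i. p i (c i)) [1..<Suc n]) Us"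
      unfolding Us_def list_all2_map1 list_all2_map2 using c
      by (auto simp: list_all2_same less_Suc_eq_le intro!: imageI)
    with reg have "poly.regular_list n {0} (map (\<lambda>i. p i (c i)) [1..<Suc n])" by blast
    moreover have "p i (c i) \<in> forms n 1" "lin_eval n v (p i (c i)) = 0" if "i \<in> {1..n}" for i
      using c[OF that] p[OF that] by auto
    ultimately show "\<forall>i\<in>{1..n}. v i = 0"
      using regular_list_linear_forms_imp[of n "\<lambda>i. p i (c i)" v] by blast
  next
    fix t assume zero: "\<forall>v. (\<forall>i\<in>{1..n}. \<exists>j\<in>{1..N i}. lin_eval n v (p i j) = 0) \<longrightarrow>
        (\<forall>i\<in>{1..n}. v i = 0)"
      and t: "list_all2 (\<lambda>u us. u \<in> set us) t Us"
    have len: "length t = n" using list_all2_lengthD[OF t] by (simp add: Us_def)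
    have t_eq: "t = map (\<lambda>i. t ! (i - 1)) [1..<Suc n]"
    proof (rule nth_equalityI)
      show "t ! k = map (\<lambda>i. t ! (i - 1)) [1..<Suc n] ! k" if "k < length t" for k
        using that len by (subst nth_map_upt) auto
    qed (simp add: len)
    have "\<exists>j\<in>{1..N i}. t ! (i - 1) = p i j" if i: "i \<in> {1..n}" for i
    proof -
      have "Us ! (i - 1) = map (p i) [1..<Suc (N i)]"
        using i unfolding Us_def by (subst nth_map_upt) auto
      moreover have "t ! (i - 1) \<in> set (Us ! (i - 1))"
        using i len by (intro list_all2_nthD[OF t]) auto
      ultimately show ?thesis by (auto)
    qed
    then have "\<forall>i\<in>{1..n}. \<exists>j. j \<in> {1..N i} \<and> t ! (i - 1) = p i j" by blast
    then obtain c where c: "\<And>i. i \<in> {1..n} \<Longrightarrow> c i \<in> {1..N i} \<and> t ! (i - 1) = p i (c i)"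
      unfolding bchoice_iff by blast
    have "poly.regular_list n {0} (map (\<lambda>i. t ! (i - 1)) [1..<Suc n])"
    proof (rule regular_list_linear_formsI)
      show "t ! (i - 1) \<in> forms n 1" if "i \<in> {1..n}" for i
        using c[OF that] p[OF that] by simp
      show "\<forall>i\<in>{1..n}. v i = 0" if "\<forall>i\<in>{1..n}. lin_eval n v (t ! (i - 1)) = 0" for v
      proof -
        have "\<exists>j\<in>{1..N i}. lin_eval n v (p i j) = 0" if i: "i \<in> {1..n}" for i
          using c[OF i] bspec[OF \<open>\<forall>i\<in>{1..n}. lin_eval n v (t ! (i - 1)) = 0\<close> i] by auto
        then show ?thesis using zero by blast
      qed
    qed
    then show "poly.regular_list n {0} t" by (simp only: t_eq[symmetric])
  qed
  ultimately show ?thesis unfolding regular_sequence_iff_regular_list by simp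
qed

lemma prod_factors_notin_seq_ideal:
  fixes \<alpha> \<beta> :: "nat \<Rightarrow> 'a::field mpoly"
  assumes reg: "regular_sequence m (\<lambda>k. \<alpha> k * \<beta> k)"
    and forms: "\<And>k. k \<in> {1..m} \<Longrightarrow> \<alpha> k \<in> forms m 1" "\<And>k. k \<in> {1..m} \<Longrightarrow> \<beta> k \<in> forms m 1"
  shows "(\<Prod>k=1..m. \<alpha> k) \<notin> seq_ideal m (\<lambda>k. \<alpha> k * \<beta> k)"
proof
  have mem: "\<alpha> k \<in> polys m" "\<beta> k \<in> polys m" if "k \<in> {1..m}" for k
    using forms[OF that] forms_subset by blast+
  let ?ps = "map (\<lambda>k. (\<alpha> k, \<beta> k)) [1..<Suc m]"
  assume "(\<Prod>k=1..m. \<alpha> k) \<in> seq_ideal m (\<lambda>k. \<alpha> k * \<beta> k)"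
  moreover have "seq_ideal m (\<lambda>k. \<alpha> k * \<beta> k) = poly.adjoin_list m {0} (map (\<lambda>(u, v). u * v) ?ps)"
    using mem by (subst seq_ideal_eq) (auto simp: o_def)
  moreover have "(\<Prod>k=1..m. \<alpha> k) = prod_list (map fst ?ps)"
    by (simp add: o_def flip: prod_list_map_upt)
  ultimately have "1 * prod_list (map fst ?ps) \<in> poly.adjoin_list m {0} (map (\<lambda>(u, v). u * v) ?ps)"
    by simp
  moreover have "poly.regular_list m {0} (map (\<lambda>(u, v). u * v) ?ps)"
    using reg unfolding regular_sequence_iff_regular_list by (simp add: o_def)
  ultimately have "1 \<in> poly.adjoin_list m {0} (map snd ?ps)"
    using mem by (intro poly.mult_prod_in_adjoin_list_imp[of ?ps])
      (auto simp: poly.ideal_in_zero)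
  then have "subst (\<lambda>_. 0) (1 :: 'a mpoly) = 0"
    by (rule subst_zero_adjoin_list)
      (use mem forms(2) in \<open>auto simp: subst_zero_forms[of _ m 1]\<close>)
  then show False by simp
qed

text \<open>
  The induced map sends a coset \<open>X\<close> to the union of the cosets of all \<open>subst \<theta> p\<close> with
  \<open>p \<in> X\<close>, which are all equal; no representative has to be chosen.
\<close>

lemma graded_alg_hom_subst:
  fixes I J :: "'a::field mpoly set"
  assumes I: "poly.ideal_in n I" and J: "poly.ideal_in m J"
    and \<theta>: "\<And>i. i \<in> {1..n} \<Longrightarrow> \<theta> i \<in> forms m 1"
    and sub: "subst \<theta> ` I \<subseteq> J"
  obtains \<phi> where "graded_alg_hom n I m J \<phi>"
    "\<And>p. p \<in> polys n \<Longrightarrow> \<phi> (I +>\<^bsub>mpoly_ring n\<^esub> p) = J +>\<^bsub>mpoly_ring m\<^esub> subst \<theta> p"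
proof -
  define \<phi> where "\<phi> = (\<lambda>X. \<Union>p\<in>X. J +>\<^bsub>mpoly_ring m\<^esub> subst \<theta> p)"
  have \<phi>: "\<phi> (I +>\<^bsub>mpoly_ring n\<^esub> p) = J +>\<^bsub>mpoly_ring m\<^esub> subst \<theta> p" for p
  proof -
    have "J +>\<^bsub>mpoly_ring m\<^esub> subst \<theta> (i + p) = J +>\<^bsub>mpoly_ring m\<^esub> subst \<theta> p" if "i \<in> I" for i
      using that sub by (auto simp: coset_eq_iff[OF J] subst_add)
    then show ?thesis
      using poly.ideal_in_0[OF I] by (auto simp: \<phi>_def coset_altdef[OF I])
  qed
  have mem: "subst \<theta> p \<in> polys m" if "p \<in> polys n" for p
    using that by (rule subst_mem) (rule forms_subset[OF \<theta>])
  have "\<phi> \<in> Ring.ring_hom (mpoly_ring n Quot I) (mpoly_ring m Quot J)"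
  proof (rule ring_hom_memI)
    show "\<phi> X \<in> carrier (mpoly_ring m Quot J)" if "X \<in> carrier (mpoly_ring n Quot I)" for X
      using that mem unfolding quotient_carrier[OF I] quotient_carrier[OF J] by (auto simp: \<phi>)
    fix X Y assume "X \<in> carrier (mpoly_ring n Quot I)" "Y \<in> carrier (mpoly_ring n Quot I)"
    then obtain p q where X: "X = I +>\<^bsub>mpoly_ring n\<^esub> p" "p \<in> polys n"
      and Y: "Y = I +>\<^bsub>mpoly_ring n\<^esub> q" "q \<in> polys n"
      unfolding quotient_carrier[OF I] by blast
    show "\<phi> (X \<otimes>\<^bsub>mpoly_ring n Quot I\<^esub> Y) = \<phi> X \<otimes>\<^bsub>mpoly_ring m Quot J\<^esub> \<phi> Y"
      using X Y mem by (simp add: \<phi> quotient_mult[OF I] quotient_mult[OF J] subst_mult)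
    show "\<phi> (X \<oplus>\<^bsub>mpoly_ring n Quot I\<^esub> Y) = \<phi> X \<oplus>\<^bsub>mpoly_ring m Quot J\<^esub> \<phi> Y"
      using X Y mem by (simp add: \<phi> quotient_add[OF I] quotient_add[OF J] subst_add)
  next
    show "\<phi> \<one>\<^bsub>mpoly_ring n Quot I\<^esub> = \<one>\<^bsub>mpoly_ring m Quot J\<^esub>"
      by (simp add: \<phi> quotient_one[OF I] quotient_one[OF J])
  qed
  moreover have "\<phi> ` graded_part n I d \<subseteq> graded_part m J d" for d
  proof
    fix Y assume "Y \<in> \<phi> ` graded_part n I d"
    then obtain p where p: "p \<in> forms n d" and "Y = \<phi> (I +>\<^bsub>mpoly_ring n\<^esub> p)"
      unfolding graded_part_def by blast
    then have Y: "Y = J +>\<^bsub>mpoly_ring m\<^esub> subst \<theta> p" by (simp only: \<phi>)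
    have "subst \<theta> p \<in> forms m d" using p by (rule subst_forms) (rule \<theta>)
    then show "Y \<in> graded_part m J d" unfolding Y graded_part_def by (rule imageI)
  qed
  ultimately have "graded_alg_hom n I m J \<phi>"
    by (simp add: graded_alg_hom_def \<phi>)
  then show ?thesis by (rule that) (rule \<phi>)
qed

section \<open>Chains of quadrics\<close>

text \<open>
  Together with the next lemma, this is the behaviour of a common zero of the quadrics along one
  row: \<open>a j\<close> is the value of the \<open>j\<close>-th factor and \<open>\<zeta> j\<close> the value of \<open>z i j\<close>. The \<open>\<zeta> j\<close> stay zero up to
  the first index with \<open>a j = \<zeta> j\<close>.
\<close>

lemma chain_has_zero:
  fixes a \<zeta> :: "nat \<Rightarrow> 'a::zero"
  assumes "M \<ge> 1" "\<zeta> 1 = 0" "a M = \<zeta> M"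
    and step: "\<And>j. j \<in> {1..<M} \<Longrightarrow> a j = \<zeta> j \<or> \<zeta> (Suc j) = \<zeta> j"
  shows "\<exists>j\<in>{1..M}. a j = 0"
proof (rule ccontr)
  assume nonzero: "\<not> (\<exists>j\<in>{1..M}. a j = 0)"
  have "\<zeta> j = 0" if "1 \<le> j" "j \<le> M" for j
    using that
  proof (induction j rule: dec_induct)
    case (step j)
    then show ?case using assms(4)[of j] nonzero by auto
  qed (rule assms(2))
  then show False using assms(1,3) nonzero by auto
qed

lemma chain_vanishes:
  fixes \<zeta> :: "nat \<Rightarrow> 'a::zero"
  assumes "\<zeta> M = 0" "1 \<le> j" "j \<le> M"
    and step: "\<And>j. j \<in> {1..<M} \<Longrightarrow> \<zeta> j = 0 \<or> \<zeta> (Suc j) = \<zeta> j"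
  shows "\<zeta> j = 0"
  using assms(3,2)
proof (induction rule: inc_induct)
  case (step j)
  then show ?case using assms(4)[of j] by auto
qed (rule assms(1))

context unital_subring
begin

text \<open>
  Writing \<open>P = a 1 * \<dots> * a (k - 1)\<close>, the \<open>k\<close>-th relation multiplied by \<open>P\<close> is \<open>P * a k * \<zeta> (k + 1)\<close> up to
  multiples of \<open>P * \<zeta> k\<close>, which drives the induction. As \<open>P * \<zeta> k\<close> vanishes modulo \<open>J\<close>, replacing each
  \<open>a j\<close> by \<open>a j - \<zeta> j\<close> does not change the product modulo \<open>J\<close>.
\<close>

lemma chain_in_ideal:
  assumes J: "ideal_in J" and "\<zeta> 1 = 0"
    and C: "\<And>j. j \<in> {1..M} \<Longrightarrow> a j \<in> C" "\<And>j. j \<in> {1..M} \<Longrightarrow> \<zeta> j \<in> C"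
    and step: "\<And>j. j \<in> {1..<M} \<Longrightarrow> (a j - \<zeta> j) * (\<zeta> (Suc j) - \<zeta> j) \<in> J"
    and "1 \<le> k" "k \<le> M"
  shows "(\<Prod>j\<in>{1..<k}. a j) * \<zeta> k \<in> J"
    and "(\<Prod>j\<in>{1..<k}. a j) - (\<Prod>j\<in>{1..<k}. a j - \<zeta> j) \<in> J"
proof -
  have "(\<Prod>j\<in>{1..<k}. a j) * \<zeta> k \<in> J \<and> (\<Prod>j\<in>{1..<k}. a j) - (\<Prod>j\<in>{1..<k}. a j - \<zeta> j) \<in> J"
    using \<open>1 \<le> k\<close> \<open>k \<le> M\<close>
  proof (induction k rule: dec_induct)
    case base
    then show ?case using assms(2) ideal_in_0[OF J] by simp
  next
    case (step k)
    define P where "P = (\<Prod>j\<in>{1..<k}. a j)"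
    define Q where "Q = (\<Prod>j\<in>{1..<k}. a j - \<zeta> j)"
    have kC: "a k \<in> C" "\<zeta> k \<in> C" "\<zeta> (Suc k) \<in> C" using C step by auto
    have PC: "P \<in> C" unfolding P_def using C step by (intro prod_mem) auto
    have IH: "P * \<zeta> k \<in> J" "P - Q \<in> J" using step by (auto simp: P_def Q_def)
    have Suc: "(\<Prod>j\<in>{1..<Suc k}. a j) = P * a k"
      "(\<Prod>j\<in>{1..<Suc k}. a j - \<zeta> j) = Q * (a k - \<zeta> k)"
      using step by (simp_all add: P_def Q_def prod.atLeastLessThan_Suc)
    have "(a k - \<zeta> k) * (\<zeta> (Suc k) - \<zeta> k) \<in> J" using step by (intro assms(5)) auto
    then have "P * ((a k - \<zeta> k) * (\<zeta> (Suc k) - \<zeta> k)) + (a k + \<zeta> (Suc k) - \<zeta> k) * (P * \<zeta> k) \<in> J"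
      using kC PC IH by (simp add: ideal_in_add[OF J] ideal_in_mult[OF J] add_mem diff_mem)
    moreover have "P * ((a k - \<zeta> k) * (\<zeta> (Suc k) - \<zeta> k)) + (a k + \<zeta> (Suc k) - \<zeta> k) * (P * \<zeta> k)
        = P * a k * \<zeta> (Suc k)"
      by (simp add: algebra_simps)
    moreover have "(a k - \<zeta> k) * (P - Q) + P * \<zeta> k \<in> J"
      using kC IH by (simp add: ideal_in_add[OF J] ideal_in_mult[OF J] diff_mem)
    moreover have "(a k - \<zeta> k) * (P - Q) + P * \<zeta> k = P * a k - Q * (a k - \<zeta> k)"
      by (simp add: algebra_simps)
    ultimately show ?case unfolding Suc by simp
  qed
  then show "(\<Prod>j\<in>{1..<k}. a j) * \<zeta> k \<in> J"
    and "(\<Prod>j\<in>{1..<k}. a j) - (\<Prod>j\<in>{1..<k}. a j - \<zeta> j) \<in> J" by auto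
qed

lemma prod_diff_in_ideal:
  assumes J: "ideal_in J"
    and "\<And>x. x \<in> A \<Longrightarrow> g x \<in> C" "\<And>x. x \<in> A \<Longrightarrow> h x \<in> C" "\<And>x. x \<in> A \<Longrightarrow> g x - h x \<in> J"
  shows "prod g A - prod h A \<in> J"
  using assms(2-)
proof (induction A rule: infinite_finite_induct)
  case (insert x A)
  have "prod g A * (g x - h x) + h x * (prod g A - prod h A) \<in> J"
    using insert prod_mem[of A g] by (intro ideal_in_add[OF J] ideal_in_mult[OF J]) auto
  also have "prod g A * (g x - h x) + h x * (prod g A - prod h A) = g x * prod g A - h x * prod h A"
    by (simp add: algebra_simps)
  finally show ?case using insert by simp
qed (simp_all add: ideal_in_0[OF J])

end

section \<open>The embedding into a quadratic complete intersection\<close>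

text \<open>
  The assumption on common zeros is the regularity of the sequence of products, in the form
  given by \<open>regular_sequence_prod_linear_iff\<close>.
\<close>

locale linear_factorization =
  fixes n :: nat and N :: "nat \<Rightarrow> nat" and p :: "nat \<Rightarrow> nat \<Rightarrow> 'a::field mpoly"
  assumes N_pos: "i \<in> {1..n} \<Longrightarrow> N i \<ge> 1"
    and p_forms: "i \<in> {1..n} \<Longrightarrow> j \<in> {1..N i} \<Longrightarrow> p i j \<in> forms n 1"
    and only_zero: "(\<And>i. i \<in> {1..n} \<Longrightarrow> \<exists>j\<in>{1..N i}. lin_eval n x (p i j) = 0) \<Longrightarrow>
      i \<in> {1..n} \<Longrightarrow> x i = 0"
begin

text \<open>
  The slots index both the quadrics and the variables of the new ring. A row with a single
  factor contributes none, which amounts to eliminating a variable.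
\<close>

definition slots :: "(nat \<times> nat) set" where
  "slots = (SIGMA i:{1..n}. {1..<N i})"

lemma finite_slots: "finite slots"
  by (simp add: slots_def)

definition socle_rep :: "'a mpoly" where
  "socle_rep = (\<Prod>i\<in>{1..n}. \<Prod>j\<in>{1..<N i}. p i j)"

abbreviation "I \<equiv> seq_ideal n (\<lambda>i. \<Prod>j=1..N i. p i j)"

lemma p_mem: "i \<in> {1..n} \<Longrightarrow> j \<in> {1..N i} \<Longrightarrow> p i j \<in> polys n"
  by (rule forms_subset[OF p_forms])

lemma f_mem: "i \<in> {1..n} \<Longrightarrow> (\<Prod>j=1..N i. p i j) \<in> polys n"
  using p_mem by (intro poly.prod_mem) blast

lemma I_eq: "I = poly.adjoin_list n {0} (map (\<lambda>i. \<Prod>j=1..N i. p i j) [1..<Suc n])"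
  using f_mem by (rule seq_ideal_eq)

lemma I_ideal: "poly.ideal_in n I"
  unfolding I_eq using f_mem by (intro poly.ideal_in_adjoin_list poly.ideal_in_zero) auto

lemma f_in_I: "i \<in> {1..n} \<Longrightarrow> (\<Prod>j=1..N i. p i j) \<in> I"
  unfolding I_eq using poly.set_subset_adjoin_list[of "{0}" "map (\<lambda>i. \<Prod>j=1..N i. p i j) [1..<Suc n]" n]
  by auto

lemma f_split: "i \<in> {1..n} \<Longrightarrow> (\<Prod>j=1..N i. p i j) = (\<Prod>j\<in>{1..<N i}. p i j) * p i (N i)"
  using N_pos[of i] by (cases "N i") (auto simp: atLeastLessThanSuc_atLeastAtMost)

lemma socle_rep_mem: "socle_rep \<in> polys n"
  unfolding socle_rep_def by (intro poly.prod_mem p_mem) auto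

lemma last_forms_zero:
  assumes "\<forall>i\<in>{1..n}. lin_eval n x (p i (N i)) = 0"
  shows "\<forall>i\<in>{1..n}. x i = 0"
proof
  fix i assume "i \<in> {1..n}"
  moreover have "\<exists>j\<in>{1..N i}. lin_eval n x (p i j) = 0" if "i \<in> {1..n}" for i
    using assms N_pos[OF that] that by (intro bexI[of _ "N i"]) auto
  ultimately show "x i = 0" by (intro only_zero[of x])
qed

lemma last_forms: "i \<in> {1..n} \<Longrightarrow> p i (N i) \<in> forms n 1"
  using p_forms N_pos by simp

text \<open>
  Multiplying by \<open>p i (N i)\<close> completes row \<open>i\<close> to the generator \<open>f i\<close>, and the variables are
  combinations of the last factors.
\<close>

lemma socle_rep_var:
  assumes k: "k \<in> {1..n}"
  shows "socle_rep * var k \<in> I"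
proof -
  obtain b where b: "\<And>j. j \<in> {1..n} \<Longrightarrow> var j = (\<Sum>i\<in>{1..n}. const_poly (b j i) * p i (N i))"
    by (rule inverse_coefficients[of n "\<lambda>i. p i (N i)", OF last_forms last_forms_zero]) blast+
  have "socle_rep * p i (N i) \<in> I" if i: "i \<in> {1..n}" for i
  proof -
    define r where "r = (\<Prod>i\<in>{1..n} - {i}. \<Prod>j\<in>{1..<N i}. p i j)"
    have "socle_rep = (\<Prod>j\<in>{1..<N i}. p i j) * r"
      unfolding socle_rep_def r_def using i by (intro prod.remove) auto
    then have "socle_rep * p i (N i) = r * (\<Prod>j=1..N i. p i j)"
      using f_split[OF i] by (simp add: ac_simps)
    moreover have "r \<in> polys n"
      unfolding r_def by (intro poly.prod_mem p_mem) auto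
    ultimately show ?thesis using poly.ideal_in_mult[OF I_ideal] f_in_I[OF i] by simp
  qed
  then have "const_poly (b k i) * (socle_rep * p i (N i)) \<in> I" if "i \<in> {1..n}" for i
    using that by (simp add: poly.ideal_in_mult[OF I_ideal])
  then have "(\<Sum>i\<in>{1..n}. const_poly (b k i) * (socle_rep * p i (N i))) \<in> I"
    by (rule poly.ideal_in_sum[OF I_ideal])
  also have "(\<Sum>i\<in>{1..n}. const_poly (b k i) * (socle_rep * p i (N i))) = socle_rep * var k"
    unfolding b[OF k] by (simp add: sum_distrib_left ac_simps)
  finally show ?thesis .
qed

end

text \<open>
  The elements \<open>z i 1 = 0\<close> and \<open>z i (j + 1) = var (e (i, j))\<close> of the new ring, for an enumeration \<open>e\<close> of
  the slots.
\<close>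

definition chain_var :: "(nat \<times> nat \<Rightarrow> nat) \<Rightarrow> nat \<Rightarrow> nat \<Rightarrow> 'a::field mpoly" where
  "chain_var e i j = (if j = 1 then 0 else var (e (i, j - 1)))"

context linear_factorization
begin

lemma slot_index:
  assumes "bij_betw e slots {1..m}" "i \<in> {1..n}" "j \<in> {1..<N i}"
  shows "(i, j) \<in> slots" "e (i, j) \<in> {1..m}"
  using bij_betwE[OF assms(1)] assms(2,3) by (auto simp: slots_def)

lemma chain_var_forms:
  assumes "bij_betw e slots {1..m}" "i \<in> {1..n}" "j \<in> {1..N i}"
  shows "(chain_var e i j :: 'a mpoly) \<in> forms m 1"
proof (cases "j = 1")
  case False
  then have "j - 1 \<in> {1..<N i}" using assms(3) by auto
  then show ?thesis
    using slot_index(2)[OF assms(1,2)] False by (simp add: chain_var_def forms_var)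
qed (simp add: chain_var_def)

end

locale quadric_chain = linear_factorization +
  fixes m :: nat and e :: "nat \<times> nat \<Rightarrow> nat" and \<theta> :: "nat \<Rightarrow> 'a mpoly"
  assumes e: "bij_betw e slots {1..m}"
    and \<theta>_forms: "i \<in> {1..n} \<Longrightarrow> \<theta> i \<in> forms m 1"
    and \<theta>_last: "i \<in> {1..n} \<Longrightarrow> subst \<theta> (p i (N i)) = chain_var e i (N i)"
begin

abbreviation z :: "nat \<Rightarrow> nat \<Rightarrow> 'a mpoly" where
  "z \<equiv> chain_var e"

lemma z_1: "z i 1 = 0"
  by (simp add: chain_var_def)

lemma z_Suc: "j \<ge> 1 \<Longrightarrow> z i (Suc j) = var (e (i, j))"
  by (simp add: chain_var_def One_nat_def)

lemma subst_p_forms: "i \<in> {1..n} \<Longrightarrow> j \<in> {1..N i} \<Longrightarrow> subst \<theta> (p i j) \<in> forms m 1"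
  by (rule subst_forms[OF p_forms \<theta>_forms])

definition \<alpha> :: "nat \<times> nat \<Rightarrow> 'a mpoly" where
  "\<alpha> = (\<lambda>(i, j). subst \<theta> (p i j) - z i j)"

definition \<beta> :: "nat \<times> nat \<Rightarrow> 'a mpoly" where
  "\<beta> = (\<lambda>(i, j). z i (Suc j) - z i j)"

lemma factor_forms:
  assumes "ij \<in> slots"
  shows "\<alpha> ij \<in> forms m 1" "\<beta> ij \<in> forms m 1"
  using assms by (auto simp: \<alpha>_def \<beta>_def slots_def intro!: forms_diff subst_p_forms chain_var_forms[OF e])

abbreviation slot :: "nat \<Rightarrow> nat \<times> nat" where
  "slot \<equiv> inv_into slots e"

lemma slot_bij: "bij_betw slot {1..m} slots"
  by (rule bij_betw_inv_into[OF e])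

lemma slot_mem: "k \<in> {1..m} \<Longrightarrow> slot k \<in> slots"
  using bij_betwE[OF slot_bij] by blast

lemma slot_e: "ij \<in> slots \<Longrightarrow> slot (e ij) = ij"
  by (rule bij_betw_inv_into_left[OF e])

definition g :: "nat \<Rightarrow> 'a mpoly" where
  "g k = \<alpha> (slot k) * \<beta> (slot k)"

text \<open>
  The point \<open>x\<close> is the image of \<open>v\<close> under the map of affine spaces dual to \<open>subst \<theta>\<close>. First
  \<open>x\<close> is the origin, by \<open>chain_has_zero\<close> in every row and the regularity of the given sequence;
  then so is \<open>v\<close>, by \<open>chain_vanishes\<close>.
\<close>

lemma only_zero_quadrics:
  assumes v: "\<And>ij. ij \<in> slots \<Longrightarrow> lin_eval m v (\<alpha> ij) = 0 \<or> lin_eval m v (\<beta> ij) = 0"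
    and k: "k \<in> {1..m}"
  shows "v k = 0"
proof -
  define x where "x = (\<lambda>i. lin_eval m v (\<theta> i))"
  define \<zeta> where "\<zeta> = (\<lambda>i j. lin_eval m v (z i j))"
  have p_x: "lin_eval m v (subst \<theta> (p i j)) = lin_eval n x (p i j)" if "i \<in> {1..n}" "j \<in> {1..N i}" for i j
    unfolding x_def by (rule lin_eval_subst[OF p_forms[OF that]])
  have last: "lin_eval n x (p i (N i)) = \<zeta> i (N i)" if "i \<in> {1..n}" for i
    using p_x[OF that, of "N i"] N_pos[OF that] \<theta>_last[OF that] by (simp add: \<zeta>_def)
  have step: "lin_eval n x (p i j) = \<zeta> i j \<or> \<zeta> i (Suc j) = \<zeta> i j"
    if "i \<in> {1..n}" "j \<in> {1..<N i}" for i j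
    using v[of "(i, j)"] slot_index[OF e that] p_x[of i j] that
    by (auto simp: \<alpha>_def \<beta>_def lin_eval_diff \<zeta>_def)
  \<comment> \<open>In every row some factor vanishes at \<open>x\<close>, so \<open>x\<close> is the origin.\<close>
  have x: "x i = 0" if "i \<in> {1..n}" for i
    using _ that
  proof (rule only_zero)
    fix i assume "i \<in> {1..n}"
    then show "\<exists>j\<in>{1..N i}. lin_eval n x (p i j) = 0"
      using N_pos last step by (intro chain_has_zero[of _ "\<zeta> i"]) (auto simp: \<zeta>_def z_1)
  qed
  have p_0: "lin_eval n x (p i j) = 0" for i j
    using x by (simp add: lin_eval_def)
  have \<zeta>: "\<zeta> i j = 0" if "i \<in> {1..n}" "j \<in> {1..N i}" for i j
  proof (rule chain_vanishes[of "\<zeta> i" "N i"])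
    show "\<zeta> i (N i) = 0" using last[OF that(1)] p_0 by simp
    show "\<zeta> i j = 0 \<or> \<zeta> i (Suc j) = \<zeta> i j" if "j \<in> {1..<N i}" for j
      using step[OF \<open>i \<in> {1..n}\<close> that] p_0 by simp
  qed (use that in auto)
  obtain i j where ij: "slot k = (i, j)" by (cases "slot k")
  then have mem: "(i, j) \<in> slots" "e (i, j) = k"
    using slot_mem[OF k] bij_betw_inv_into_right[OF e k] by auto
  then have "\<zeta> i (Suc j) = v k"
    using k by (auto simp: \<zeta>_def slots_def z_Suc lin_eval_var)
  then show ?thesis using \<zeta>[of i "Suc j"] mem by (auto simp: slots_def)
qed

lemma quadratic_regular_sequence_g: "quadratic_regular_sequence m g"
proof -
  define q where "q = (\<lambda>k j. if j = (1::nat) then \<alpha> (slot k) else \<beta> (slot k))"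
  have g_eq: "g = (\<lambda>k. \<Prod>j=1..2. q k j)"
    by (simp add: fun_eq_iff g_def q_def numeral_2_eq_2 One_nat_def)
  have q_forms: "q k j \<in> forms m 1" if "k \<in> {1..m}" for k j
    using factor_forms[OF slot_mem[OF that]] by (simp add: q_def)
  have "regular_sequence m (\<lambda>k. \<Prod>j=1..2. q k j)"
  proof (subst regular_sequence_prod_linear_iff, goal_cases)
    case 3
    show ?case
    proof (intro allI impI ballI)
      fix v k assume v: "\<forall>k\<in>{1..m}. \<exists>j\<in>{1..2}. lin_eval m v (q k j) = 0" and k: "k \<in> {1..m}"
      have "lin_eval m v (\<alpha> ij) = 0 \<or> lin_eval m v (\<beta> ij) = 0" if "ij \<in> slots" for ij
      proof -
        have "e ij \<in> {1..m}" using bij_betwE[OF e] that by blast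
        with v obtain j where "lin_eval m v (q (e ij) j) = 0" by blast
        then show ?thesis by (auto simp: q_def slot_e[OF that] split: if_splits)
      qed
      then show "v k = 0" using k by (rule only_zero_quadrics)
    qed
  qed (use q_forms in auto)
  moreover have "g k \<in> forms m 2" if "k \<in> {1..m}" for k
    using forms_mult[OF factor_forms[OF slot_mem[OF that]]] by (simp add: g_def)
  ultimately show ?thesis
    unfolding quadratic_regular_sequence_def g_eq by simp
qed

abbreviation "J \<equiv> seq_ideal m g"

lemma g_mem: "k \<in> {1..m} \<Longrightarrow> g k \<in> polys m"
  using factor_forms[OF slot_mem] forms_subset unfolding g_def by blast

lemma J_eq: "J = poly.adjoin_list m {0} (map g [1..<Suc m])"
  using g_mem by (rule seq_ideal_eq)

lemma J_ideal: "poly.ideal_in m J"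
  unfolding J_eq using g_mem by (intro poly.ideal_in_adjoin_list poly.ideal_in_zero) auto

lemma quadric_in_J: "ij \<in> slots \<Longrightarrow> \<alpha> ij * \<beta> ij \<in> J"
proof -
  assume ij: "ij \<in> slots"
  then have "e ij \<in> {1..m}" using bij_betwE[OF e] by blast
  then have "g (e ij) \<in> J"
    unfolding J_eq using poly.set_subset_adjoin_list[of "{0}" "map g [1..<Suc m]" m] by auto
  then show ?thesis by (simp add: g_def slot_e[OF ij])
qed

lemma row_chain:
  assumes i: "i \<in> {1..n}"
  shows "(\<Prod>j\<in>{1..<N i}. subst \<theta> (p i j)) * z i (N i) \<in> J"
    and "(\<Prod>j\<in>{1..<N i}. subst \<theta> (p i j)) - (\<Prod>j\<in>{1..<N i}. \<alpha> (i, j)) \<in> J"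
proof -
  have "(subst \<theta> (p i j) - z i j) * (z i (Suc j) - z i j) \<in> J" if "j \<in> {1..<N i}" for j
    using quadric_in_J[of "(i, j)"] slot_index[OF e i that] by (simp add: \<alpha>_def \<beta>_def)
  then have "(\<Prod>j\<in>{1..<N i}. subst \<theta> (p i j)) * z i (N i) \<in> J \<and>
      (\<Prod>j\<in>{1..<N i}. subst \<theta> (p i j)) - (\<Prod>j\<in>{1..<N i}. subst \<theta> (p i j) - z i j) \<in> J"
    using i N_pos[OF i] forms_subset[OF subst_p_forms] forms_subset[OF chain_var_forms[OF e]]
    by (intro conjI poly.chain_in_ideal[OF J_ideal, of "z i" "N i" "\<lambda>j. subst \<theta> (p i j)"] z_1) auto
  then show "(\<Prod>j\<in>{1..<N i}. subst \<theta> (p i j)) * z i (N i) \<in> J"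
    and "(\<Prod>j\<in>{1..<N i}. subst \<theta> (p i j)) - (\<Prod>j\<in>{1..<N i}. \<alpha> (i, j)) \<in> J"
    by (simp_all add: \<alpha>_def)
qed

lemma subst_I: "subst \<theta> ` I \<subseteq> J"
proof -
  let ?K = "{q \<in> polys n. subst \<theta> q \<in> J}"
  have mem: "subst \<theta> q \<in> polys m" if "q \<in> polys n" for q
    using that by (rule subst_mem) (rule forms_subset[OF \<theta>_forms])
  have "poly.ideal_in n ?K"
    unfolding poly.ideal_in_def
    using mem poly.ideal_in_0[OF J_ideal] poly.ideal_in_add[OF J_ideal] poly.ideal_in_mult[OF J_ideal]
    by (auto simp: subst_add subst_mult)
  moreover have "(\<Prod>j=1..N i. p i j) \<in> ?K" if "i \<in> {1..n}" for i
    using row_chain(1)[OF that] f_mem[OF that] f_split[OF that]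
    by (simp add: subst_mult subst_prod \<theta>_last[OF that])
  ultimately have "I \<subseteq> ?K"
    unfolding I_eq using poly.ideal_in_0[OF J_ideal] by (intro poly.adjoin_list_least) auto
  then show ?thesis by blast
qed

lemma subst_socle_rep: "subst \<theta> socle_rep - (\<Prod>ij\<in>slots. \<alpha> ij) \<in> J"
proof -
  have "(\<Prod>ij\<in>slots. \<alpha> ij) = (\<Prod>i\<in>{1..n}. \<Prod>j\<in>{1..<N i}. \<alpha> (i, j))"
    by (simp add: slots_def prod.Sigma)
  moreover have "subst \<theta> socle_rep = (\<Prod>i\<in>{1..n}. \<Prod>j\<in>{1..<N i}. subst \<theta> (p i j))"
    by (simp add: socle_rep_def subst_prod)
  moreover have "\<alpha> (i, j) \<in> polys m" "subst \<theta> (p i j) \<in> polys m"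
    if "i \<in> {1..n}" "j \<in> {1..<N i}" for i j
    using that factor_forms(1)[of "(i, j)"] subst_p_forms[of i j] forms_subset
    by (auto simp: slots_def)
  ultimately show ?thesis
    using row_chain(2) by (simp only:) (rule poly.prod_diff_in_ideal[OF J_ideal]; (rule poly.prod_mem)?; simp)
qed

text \<open>
  Modulo \<open>J\<close> the image of \<open>socle_rep\<close> is the product of the first factors of the quadrics.
\<close>

lemma subst_socle_rep_notin: "subst \<theta> socle_rep \<notin> J"
proof -
  have "(\<Prod>ij\<in>slots. \<alpha> ij) = (\<Prod>k=1..m. \<alpha> (slot k))"
    by (rule prod.reindex_bij_betw[OF slot_bij, symmetric])
  moreover have "(\<Prod>k=1..m. \<alpha> (slot k)) \<notin> seq_ideal m (\<lambda>k. \<alpha> (slot k) * \<beta> (slot k))"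
    using quadratic_regular_sequence_g factor_forms[OF slot_mem]
    unfolding quadratic_regular_sequence_def g_def[abs_def]
    by (intro prod_factors_notin_seq_ideal) auto
  ultimately have "(\<Prod>ij\<in>slots. \<alpha> ij) \<notin> J" by (simp add: g_def[abs_def])
  then show ?thesis using poly.ideal_in_cong[OF J_ideal subst_socle_rep] by simp
qed

text \<open>
  The product \<open>t\<close> of the first factors of the quadrics is annihilated by the second factors
  \<open>z i (j + 1) - z i j\<close>. Since \<open>z i 1 = 0\<close>, it is annihilated by all \<open>z i j\<close>, that is, by all
  variables.
\<close>

lemma subst_socle_rep_var:
  assumes k: "k \<in> {1..m}"
  shows "subst \<theta> socle_rep * var k \<in> J"
proof -
  define t where "t = (\<Prod>ij\<in>slots. \<alpha> ij)"
  have t_z: "t * z i j \<in> J" if i: "i \<in> {1..n}" and "1 \<le> j" "j \<le> N i" for i j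
    using that(2,3)
  proof (induction j rule: dec_induct)
    case base
    then show ?case using poly.ideal_in_0[OF J_ideal] by (simp add: z_1)
  next
    case (step j)
    then have ij: "(i, j) \<in> slots" using i by (simp add: slots_def)
    define r where "r = (\<Prod>ij\<in>slots - {(i, j)}. \<alpha> ij)"
    have "t = \<alpha> (i, j) * r"
      unfolding t_def r_def by (rule prod.remove[OF finite_slots ij])
    then have "t * z i (Suc j) = r * (\<alpha> (i, j) * \<beta> (i, j)) + t * z i j"
      by (simp add: \<beta>_def algebra_simps)
    moreover have "r \<in> polys m"
      unfolding r_def using factor_forms(1) forms_subset by (intro poly.prod_mem) blast
    ultimately show ?case
      using step quadric_in_J[OF ij]
      by (simp add: poly.ideal_in_add[OF J_ideal] poly.ideal_in_mult[OF J_ideal])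
  qed
  obtain i j where ij: "slot k = (i, j)" by (cases "slot k")
  then have mem: "(i, j) \<in> slots" "e (i, j) = k"
    using slot_mem[OF k] bij_betw_inv_into_right[OF e k] by auto
  then have "t * var k \<in> J"
    using t_z[of i "Suc j"] by (auto simp: slots_def z_Suc)
  moreover have "var k * (subst \<theta> socle_rep - t) \<in> J"
    using subst_socle_rep var_mem[OF k] unfolding t_def by (intro poly.ideal_in_mult[OF J_ideal])
  then have "subst \<theta> socle_rep * var k - t * var k \<in> J" by (simp add: algebra_simps)
  ultimately show ?thesis using poly.ideal_in_cong[OF J_ideal] by blast
qed

lemma embedding: "\<exists>\<phi>. ci_embedding n I m J \<phi>"
proof -
  obtain \<phi> where \<phi>: "graded_alg_hom n I m J \<phi>"
    "\<And>q. q \<in> polys n \<Longrightarrow> \<phi> (I +>\<^bsub>mpoly_ring n\<^esub> q) = J +>\<^bsub>mpoly_ring m\<^esub> subst \<theta> q"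
    using graded_alg_hom_subst[OF I_ideal J_ideal \<theta>_forms subst_I] by blast
  let ?s = "I +>\<^bsub>mpoly_ring n\<^esub> socle_rep"
  have "socle_rep \<notin> I" using subst_I subst_socle_rep_notin by blast
  then have "socle_generator n I ?s"
    using coset_in_socle[OF I_ideal socle_rep_mem socle_rep_var]
    by (simp add: socle_generator_def quotient_zero[OF I_ideal] coset_eq_ideal_iff[OF I_ideal])
  moreover have "subst \<theta> socle_rep \<in> polys m"
    using socle_rep_mem by (rule subst_mem) (rule forms_subset[OF \<theta>_forms])
  then have "socle_generator m J (\<phi> ?s)"
    using coset_in_socle[OF J_ideal _ subst_socle_rep_var] subst_socle_rep_notin
    by (simp add: socle_generator_def quotient_zero[OF J_ideal] coset_eq_ideal_iff[OF J_ideal]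
        \<phi>(2)[OF socle_rep_mem])
  ultimately show ?thesis unfolding ci_embedding_def using \<phi>(1) by blast
qed

lemma ex_quadratic_embedding:
  "\<exists>m g \<phi>. quadratic_regular_sequence m g \<and> ci_embedding n I m (seq_ideal m g) \<phi>"
  using quadratic_regular_sequence_g embedding by blast

end

theorem theorem1p1:
  fixes n :: nat and f :: "nat \<Rightarrow> 'a::field mpoly"
  assumes "n \<ge> 1"
    and "regular_sequence n f"
    and "\<And>i. i \<in> {1..n} \<Longrightarrow>
      \<exists>(N::nat) (l :: nat \<Rightarrow> 'a mpoly). (\<forall>j\<in>{1..N}. l j \<in> forms n 1) \<and> f i = (\<Prod>j=1..N. l j)"
  shows "\<exists>(m::nat) (g :: nat \<Rightarrow> 'a mpoly) \<phi>.
    quadratic_regular_sequence m g \<and> ci_embedding n (seq_ideal n f) m (seq_ideal m g) \<phi>"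
proof -
  have "\<forall>i\<in>{1..n}. \<exists>(N::nat) (l :: nat \<Rightarrow> 'a mpoly).
      (\<forall>j\<in>{1..N}. l j \<in> forms n 1) \<and> f i = (\<Prod>j=1..N. l j)"
    using assms(3) by (rule ballI)
  then obtain N :: "nat \<Rightarrow> nat" and p :: "nat \<Rightarrow> nat \<Rightarrow> 'a mpoly" where Np: "\<forall>i\<in>{1..n}. (\<forall>j\<in>{1..N i}. p i j \<in> forms n 1) \<and> f i = (\<Prod>j=1..N i. p i j)"
    unfolding bchoice_iff by blast
  have p: "p i j \<in> forms n 1" if "i \<in> {1..n}" "j \<in> {1..N i}" for i j
    using bspec[OF Np that(1)] that(2) by blast
  have f: "f i = (\<Prod>j=1..N i. p i j)" if "i \<in> {1..n}" for i
    using bspec[OF Np that] by blast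
  have N: "N i \<ge> 1" if i: "i \<in> {1..n}" for i
  proof (rule ccontr)
    \<comment> \<open>An empty product is \<open>1\<close>, which is not a form of positive degree.\<close>
    assume "\<not> N i \<ge> 1"
    then have "f i = 1" using f[OF i] by simp
    moreover obtain d where "d > 0" "f i \<in> forms n d"
      using assms(2) i unfolding regular_sequence_def by blast
    ultimately show False using subst_zero_forms[of 1 n d] by simp
  qed
  have regular_eq: "regular_sequence n f = regular_sequence n (\<lambda>i. \<Prod>j=1..N i. p i j)"
    by (rule regular_sequence_cong[OF f])
  have ideal_eq: "seq_ideal n f = seq_ideal n (\<lambda>i. \<Prod>j=1..N i. p i j)"
    by (rule seq_ideal_cong[OF f])
  interpret linear_factorization n N p
  proof
    fix x :: "nat \<Rightarrow> 'a" and i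
    assume zeros: "\<And>i. i \<in> {1..n} \<Longrightarrow> \<exists>j\<in>{1..N i}. lin_eval n x (p i j) = 0"
      and i: "i \<in> {1..n}"
    have "\<forall>x. (\<forall>i\<in>{1..n}. \<exists>j\<in>{1..N i}. lin_eval n x (p i j) = 0) \<longrightarrow> (\<forall>i\<in>{1..n}. x i = 0)"
      using assms(2) regular_eq regular_sequence_prod_linear_iff[of n N p, OF N p] by simp
    then have "\<forall>i\<in>{1..n}. x i = 0" using zeros by simp
    then show "x i = 0" using i by (rule bspec)
  qed (use N p in auto)
  obtain e where e: "bij_betw e slots {1..card slots}"
    using finite_same_card_bij[OF finite_slots finite_atLeastAtMost[of 1 "card slots"]] by auto
  \<comment> \<open>The last factors are a basis of the linear forms, so the images of these can be prescribed.\<close>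
  obtain b where b: "\<And>i c. i \<in> {1..n} \<Longrightarrow>
      subst (\<lambda>j. \<Sum>k\<in>{1..n}. const_poly (b j k) * c k) (p i (N i)) = c i"
    by (rule inverse_coefficients[of n "\<lambda>i. p i (N i)", OF last_forms last_forms_zero]) blast+
  define \<theta> where "\<theta> = (\<lambda>j. \<Sum>k\<in>{1..n}. const_poly (b j k) * chain_var e k (N k))"
  have \<theta>_last: "subst \<theta> (p i (N i)) = chain_var e i (N i)" if "i \<in> {1..n}" for i
    using b[OF that, of "\<lambda>k. chain_var e k (N k)"] by (simp only: \<theta>_def)
  have "(chain_var e k (N k) :: 'a mpoly) \<in> forms (card slots) 1" if "k \<in> {1..n}" for k
    by (rule chain_var_forms[OF e that]) (use N[OF that] in simp)
  then have \<theta>_forms: "\<theta> i \<in> forms (card slots) 1" for i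
    unfolding \<theta>_def by (intro forms_sum forms_const_mult)
  have chain: "quadric_chain n N p (card slots) e \<theta>"
  proof
    show "bij_betw e slots {1..card slots}" by (rule e)
  qed (use \<theta>_forms \<theta>_last in auto)
  show ?thesis
    unfolding ideal_eq by (rule quadric_chain.ex_quadratic_embedding[OF chain])
qed

end
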